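(* Let $0<p<1$ and let $\mathcal{M}=\{M_n\}_{n\ge 0}$ be a weight sequence which is logarithmically convex and bounded away from zero. Let $\mathcal{N}=\{N_n\}_{n\ge0}$ be given by \[ N_n=\prod_{j=1}^{\infty}M_{n+j}^{(1-p)^{j-1}p},\qquad n=0,1,2,\ldots. \] If $\kappa(p,\mathcal{M})<+\infty$, the following holds: (i) If $\theta>0$, then $\mathcal{C}_{\mathcal{M}}^{p,\theta}$ is never quasianalytic. (ii) If $\theta=0$ and $\mathcal{M}$ is decay-regular, then $\mathcal{C}_{\mathcal{M}}^{p,0}$ is quasianalytic if and only if the Carleman class $\mathcal{C}_{\mathcal{N}}$ is quasianalytic.
   Context: $\|f\|_p=(\int_{\mathbb{R}}|f|^p\,dx)^{1/p}$ is the quasinorm of $L^p=L^p(\mathbb{R})$. A weight sequence $\mathcal{M}=\{M_n\}_{n\ge 0}$ is a sequence of positive real numbers; it is logarithmically convex if $n\mapsto\log M_n$ is convex. The $p$-characteristic is $\kappa(p,\mathcal{M})=\limsup_{n\to+\infty}\sum_{j=1}^{n}(1-p)^j\log M_j$. A logarithmically convex $\mathcal{M}$ with $\kappa(p,\mathcal{M})<+\infty$ is called decay-regular if either $M_n/M_{n+1}\ge\epsilon^n$ holds (for all $n$) for some real $\epsilon>0$, or alternatively $\sum_{n=1}^{+\infty}M_n/M_{n+1}<+\infty$. For $f\in C^\infty(\mathbb{R})$ put $\|f\|_{p,\mathcal{M}}=\sup_{n\ge 0}\|f^{(n)}\|_p/M_n$. For $\theta\ge 0$ the test class is \[ \mathscr{S}_{p,\theta,\mathcal{M}}^\circledast=\Big\{f\in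 C^\infty(\mathbb{R}):\ \|f\|_{p,\mathcal{M}}<+\infty\ \text{ and }\ \limsup_{n\to+\infty}(1-p)^n\log\|f^{(n)}\|_\infty\le\theta\Big\} \] (with $\log 0=-\infty$). The $L^p$-Carleman space $W^{p,\theta}_{\mathcal{M}}$ is the abstract completion of $\mathscr{S}_{p,\theta,\mathcal{M}}^\circledast$ with respect to $\|\cdot\|_{p,\mathcal{M}}$; via the continuous extension of $f\mapsto(f,f',f'',\ldots)$ its elements are identified with elements of $L^p\times L^p\times\cdots$. When $\kappa(p,\mathcal{M})<+\infty$, these are of the form $(f,f',f'',\ldots)$ with $f\in C^\infty(\mathbb{R})$, and $W^{p,\theta}_{\mathcal{M}}$ is in this way regarded as a space of smooth functions. The $L^p$-Carleman class $\mathcal{C}^{p,\theta}_{\mathcal{M}}$ consists of all dilates $f_a(t)=f(at)$, $a>0$, of functions $f\in W^{p,\theta}_{\mathcal{M}}$. The Carleman class $\mathcal{C}_{\mathcal{N}}$ consists of all $f\in C^\infty(\mathbb{R})$ for which there are positive constants $C,A$ (depending on $f$) with $\|f^{(k)}\|_\infty\le CA^kN_k$ for all $k\ge0$. A class of smooth functions on $\mathbb{R}$ is quasianalytic if the formal Taylor series at any given point determines a function in the class uniquely, i.e. if the only $f$ in the class with $f^{(n)}(a)=0$ for all $n\ge 0$, for some $a\in\mathbb{R}$, is $f=0$. *)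

theory Defs
  imports "HOL-Analysis.Analysis"
begin

(* Functions on the line are complex-valued. *)

definition nth_deriv :: "nat \<Rightarrow> (real \<Rightarrow> complex) \<Rightarrow> real \<Rightarrow> complex" where
  "nth_deriv n f = ((\<lambda>g x. vector_derivative g (at x)) ^^ n) f"

definition smooth_fun :: "(real \<Rightarrow> complex) \<Rightarrow> bool" where
  "smooth_fun f \<longleftrightarrow> (\<forall>n x. nth_deriv n f differentiable (at x))"

definition Lp_norm :: "real \<Rightarrow> (real \<Rightarrow> complex) \<Rightarrow> ennreal" where
  "Lp_norm p f =
     (let I = (\<integral>\<^sup>+ x. ennreal (norm (f x) powr p) \<partial>lborel)
      in if I = \<infinity> then \<infinity> else ennreal (enn2real I powr (1 / p)))"

(* Only applied to continuous functions, for which the supremum is the essential supremum. *)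
definition sup_norm :: "(real \<Rightarrow> complex) \<Rightarrow> ennreal" where
  "sup_norm f = (SUP x. ennreal (norm (f x)))"

definition ext_ln :: "ennreal \<Rightarrow> ereal" where
  "ext_ln x = (if x = 0 then -\<infinity> else if x = \<infinity> then \<infinity> else ereal (ln (enn2real x)))"

definition weight_sequence :: "(nat \<Rightarrow> real) \<Rightarrow> bool" where
  "weight_sequence M \<longleftrightarrow> (\<forall>n. M n > 0)"

definition log_convex :: "(nat \<Rightarrow> real) \<Rightarrow> bool" where
  "log_convex M \<longleftrightarrow> (\<forall>n. ln (M (n + 1)) \<le> (ln (M n) + ln (M (n + 2))) / 2)"

definition p_characteristic :: "real \<Rightarrow> (nat \<Rightarrow> real) \<Rightarrow> ereal" where
  "p_characteristic p M = limsup (\<lambda>n. ereal (\<Sum>j=1..n. (1 - p) ^ j * ln (M j)))"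

definition decay_regular :: "real \<Rightarrow> (nat \<Rightarrow> real) \<Rightarrow> bool" where
  "decay_regular p M \<longleftrightarrow>
     log_convex M \<and> p_characteristic p M < \<infinity> \<and>
     ((\<exists>\<epsilon>>0. \<forall>n. M n / M (n + 1) \<ge> \<epsilon> ^ n) \<or>
      summable (\<lambda>n. M (n + 1) / M (n + 2)))"

definition carleman_norm :: "real \<Rightarrow> (nat \<Rightarrow> real) \<Rightarrow> (real \<Rightarrow> complex) \<Rightarrow> ennreal" where
  "carleman_norm p M f = (SUP n. Lp_norm p (nth_deriv n f) / ennreal (M n))"

definition test_class :: "real \<Rightarrow> real \<Rightarrow> (nat \<Rightarrow> real) \<Rightarrow> (real \<Rightarrow> complex) set" where
  "test_class p \<theta> M =
     {f. smooth_fun f \<and> carleman_norm p M f < \<infinity> \<and>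
         limsup (\<lambda>n. ereal ((1 - p) ^ n) * ext_ln (sup_norm (nth_deriv n f))) \<le> ereal \<theta>}"

(* The abstract completion of the test class: Cauchy sequences modulo null sequences. *)

definition carleman_Cauchy ::
    "real \<Rightarrow> real \<Rightarrow> (nat \<Rightarrow> real) \<Rightarrow> (nat \<Rightarrow> real \<Rightarrow> complex) \<Rightarrow> bool" where
  "carleman_Cauchy p \<theta> M F \<longleftrightarrow>
     (\<forall>i. F i \<in> test_class p \<theta> M) \<and>
     (\<forall>e>0::real. \<exists>K. \<forall>i\<ge>K. \<forall>j\<ge>K. carleman_norm p M (\<lambda>x. F i x - F j x) < ennreal e)"

definition carleman_equiv ::
    "real \<Rightarrow> real \<Rightarrow> (nat \<Rightarrow> real) \<Rightarrow> ((nat \<Rightarrow> real \<Rightarrow> complex) \<times> (nat \<Rightarrow> real \<Rightarrow> complex)) set" where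
  "carleman_equiv p \<theta> M =
     {(F, G). carleman_Cauchy p \<theta> M F \<and> carleman_Cauchy p \<theta> M G \<and>
        (\<lambda>i. carleman_norm p M (\<lambda>x. F i x - G i x)) \<longlonglongrightarrow> 0}"

definition carleman_completion ::
    "real \<Rightarrow> real \<Rightarrow> (nat \<Rightarrow> real) \<Rightarrow> (nat \<Rightarrow> real \<Rightarrow> complex) set set" where
  "carleman_completion p \<theta> M = {F. carleman_Cauchy p \<theta> M F} // carleman_equiv p \<theta> M"

(* h represents the image of the completion element X in L^p x L^p x ... under the
   continuous extension of f |-> (f, f', f'', ...); each h n matters only up to null sets. *)
definition represents_in_Lp ::
    "real \<Rightarrow> (nat \<Rightarrow> real \<Rightarrow> complex) set \<Rightarrow> (nat \<Rightarrow> real \<Rightarrow> complex) \<Rightarrow> bool" where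
  "represents_in_Lp p X h \<longleftrightarrow>
     (\<forall>F\<in>X. \<forall>n. (\<lambda>i. Lp_norm p (\<lambda>x. nth_deriv n (F i) x - h n x)) \<longlonglongrightarrow> 0)"

(* The L^p-Carleman space, regarded as a space of smooth functions (p_characteristic p M < \<infinity>). *)
definition carleman_space :: "real \<Rightarrow> real \<Rightarrow> (nat \<Rightarrow> real) \<Rightarrow> (real \<Rightarrow> complex) set" where
  "carleman_space p \<theta> M =
     {f. smooth_fun f \<and>
         (\<exists>X\<in>carleman_completion p \<theta> M. represents_in_Lp p X (\<lambda>n. nth_deriv n f))}"

definition Lp_carleman_class :: "real \<Rightarrow> real \<Rightarrow> (nat \<Rightarrow> real) \<Rightarrow> (real \<Rightarrow> complex) set" where
  "Lp_carleman_class p \<theta> M = {\<lambda>t. f (a * t) | f a. f \<in> carleman_space p \<theta> M \<and> a > 0}"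

definition carleman_class :: "(nat \<Rightarrow> real) \<Rightarrow> (real \<Rightarrow> complex) set" where
  "carleman_class N =
     {f. smooth_fun f \<and>
         (\<exists>C>0. \<exists>A>0. \<forall>k. sup_norm (nth_deriv k f) \<le> ennreal (C * A ^ k * N k))}"

definition quasianalytic :: "(real \<Rightarrow> complex) set \<Rightarrow> bool" where
  "quasianalytic \<C> \<longleftrightarrow>
     (\<forall>f\<in>\<C>. (\<exists>a. \<forall>n. nth_deriv n f a = 0) \<longrightarrow> f = (\<lambda>x. 0))"

end

theory Submission
  imports Defs
begin

text \<open>
  For a test function \<open>f\<close> with \<open>\<theta> = 0\<close>, one has \<open>sup \<bar>g\<bar> \<le> \<integral> \<bar>g'\<bar> \<le> (sup \<bar>g'\<bar>) powr (1 - p) * \<integral> \<bar>g'\<bar> powr p\<close>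
  for every derivative \<open>g\<close> of \<open>f\<close>. Iterating this bounds the \<open>n\<close>-th derivative of \<open>f\<close> by \<open>N n\<close> times the
  Carleman norm of \<open>f\<close>; the bound passes to the completion, so the class lies in the Carleman class of
  \<open>N\<close>. Conversely, if the latter is not quasianalytic, Bang's argument shows that \<open>N n / N (n + 1)\<close> is
  summable, and decay regularity transfers this to \<open>M n / M (n + 1)\<close>.

  The nonzero flat functions needed are infinite convolutions of uniform densities on \<open>[0, a k]\<close>. The
  \<open>n\<close>-th derivative has size about \<open>\<Prod>k\<le>n. 1 / a k\<close> on \<open>2 ^ n\<close> intervals of length
  \<open>\<Sum>k\<ge>n. a k\<close>. For \<open>\<theta> = 0\<close> one takes \<open>a k\<close> proportional to \<open>M (k - 1) / M k\<close>. For
  \<open>\<theta> > 0\<close> the choice \<open>ln (a k) = ln 2 / p - \<theta> p (1 - p) ^ (- k)\<close> makes the small support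
  compensate the size, so that all \<open>p\<close>-norms stay bounded.
\<close>

section \<open>Derivatives and norms\<close>

lemma nth_deriv_0 [simp]: "nth_deriv 0 f = f"
  by (simp add: nth_deriv_def)

lemma nth_deriv_Suc: "nth_deriv (Suc n) f x = vector_derivative (nth_deriv n f) (at x)"
  by (simp add: nth_deriv_def)

lemma smooth_fun_has_vector_derivative:
  assumes "smooth_fun f"
  shows "(nth_deriv n f has_vector_derivative nth_deriv (Suc n) f x) (at x)"
  using assms unfolding smooth_fun_def nth_deriv_Suc
  by (simp add: vector_derivative_works)

text \<open>Identifies all iterated derivatives at once: it suffices to guess the family
  \<open>D\<close> and to check that each member differentiates to the next. Differences, dilates
  and the bump are treated this way.\<close>

lemma nth_deriv_unique:
  assumes "\<And>n x. (D n has_vector_derivative D (Suc n) x) (at x)"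
  shows "nth_deriv n (D 0) = D n"
proof (induction n)
  case (Suc n)
  show ?case
    by (rule ext) (simp add: nth_deriv_Suc Suc vector_derivative_at[OF assms])
qed simp

lemma smooth_funI:
  assumes "\<And>n x. (D n has_vector_derivative D (Suc n) x) (at x)"
  shows "smooth_fun (D 0)"
  unfolding smooth_fun_def nth_deriv_unique[of D, OF assms]
  using assms differentiableI_vector by blast

lemma smooth_fun_diff:
  assumes "smooth_fun f" "smooth_fun g"
  shows "smooth_fun (\<lambda>x. f x - g x)"
    and "nth_deriv n (\<lambda>x. f x - g x) = (\<lambda>x. nth_deriv n f x - nth_deriv n g x)"
proof -
  define D where "D = (\<lambda>n x. nth_deriv n f x - nth_deriv n g x)"
  have D: "(D n has_vector_derivative D (Suc n) x) (at x)" for n x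
    unfolding D_def using assms
    by (intro has_vector_derivative_diff smooth_fun_has_vector_derivative)
  have D0: "D 0 = (\<lambda>x. f x - g x)"
    by (simp add: D_def)
  show "smooth_fun (\<lambda>x. f x - g x)"
    using smooth_funI[of D, OF D] D0 by simp
  show "nth_deriv n (\<lambda>x. f x - g x) = (\<lambda>x. nth_deriv n f x - nth_deriv n g x)"
    using nth_deriv_unique[of D n, OF D] D0 by (simp add: D_def)
qed

lemma smooth_fun_dilate:
  fixes a :: real
  assumes "smooth_fun f"
  shows "smooth_fun (\<lambda>x. f (a * x))"
    and "nth_deriv n (\<lambda>x. f (a * x)) = (\<lambda>x. a ^ n *\<^sub>R nth_deriv n f (a * x))"
proof -
  define D where "D = (\<lambda>n x. a ^ n *\<^sub>R nth_deriv n f (a * x))"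
  have D: "(D n has_vector_derivative D (Suc n) x) (at x)" for n x
  proof -
    have "((nth_deriv n f \<circ> (\<lambda>x. a * x)) has_vector_derivative (a *\<^sub>R nth_deriv (Suc n) f (a * x))) (at x)"
      by (rule vector_diff_chain_at)
        (auto intro!: derivative_eq_intros smooth_fun_has_vector_derivative[OF assms])
    from has_vector_derivative_scaleR[OF DERIV_const this, of "a ^ n"]
    show ?thesis
      by (simp add: D_def o_def mult.commute)
  qed
  have D0: "D 0 = (\<lambda>x. f (a * x))"
    by (simp add: D_def)
  show "smooth_fun (\<lambda>x. f (a * x))"
    using smooth_funI[of D, OF D] D0 by simp
  show "nth_deriv n (\<lambda>x. f (a * x)) = (\<lambda>x. a ^ n *\<^sub>R nth_deriv n f (a * x))"
    using nth_deriv_unique[of D n, OF D] D0 by (simp add: D_def)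
qed

section \<open>Norm bounds restated as pointwise and integral bounds\<close>

lemma sup_norm_le_iff:
  assumes "0 \<le> c"
  shows "sup_norm f \<le> ennreal c \<longleftrightarrow> (\<forall>x. norm (f x) \<le> c)"
  using assms by (simp add: sup_norm_def SUP_le_iff ennreal_le_iff)

lemma Lp_norm_le_iff:
  assumes "0 < p" "0 \<le> c"
  shows "Lp_norm p f \<le> ennreal c \<longleftrightarrow>
    (\<integral>\<^sup>+ x. ennreal (norm (f x) powr p) \<partial>lborel) \<le> ennreal (c powr p)"
proof (cases "(\<integral>\<^sup>+ x. ennreal (norm (f x) powr p) \<partial>lborel)")
  case (real r)
  have "r powr (1 / p) \<le> c \<longleftrightarrow> r \<le> c powr p"
  proof
    assume "r powr (1 / p) \<le> c"
    then have "(r powr (1 / p)) powr p \<le> c powr p"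
      using assms by (intro powr_mono2) auto
    then show "r \<le> c powr p"
      using assms real by (simp add: powr_powr)
  next
    assume "r \<le> c powr p"
    then have "r powr (1 / p) \<le> (c powr p) powr (1 / p)"
      using assms real by (intro powr_mono2) auto
    then show "r powr (1 / p) \<le> c"
      using assms by (simp add: powr_powr)
  qed
  then show ?thesis
    using real assms by (simp add: Lp_norm_def ennreal_le_iff)
next
  case top
  then show ?thesis
    by (simp add: Lp_norm_def top_unique)
qed

lemma carleman_norm_le_iff:
  assumes "weight_sequence M" "0 \<le> K"
  shows "carleman_norm p M f \<le> ennreal K \<longleftrightarrow> (\<forall>n. Lp_norm p (nth_deriv n f) \<le> ennreal (K * M n))"
proof -
  have "x / ennreal (M n) \<le> ennreal K \<longleftrightarrow> x \<le> ennreal (K * M n)" for x n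
  proof -
    have M: "M n > 0" using assms by (simp add: weight_sequence_def)
    show ?thesis
    proof (cases x)
      case (real r)
      then show ?thesis
        using M assms by (simp add: divide_ennreal ennreal_le_iff pos_divide_le_eq)
    next
      case top
      then show ?thesis
        using M by (simp add: top_unique ennreal_top_divide)
    qed
  qed
  then show ?thesis
    by (simp add: carleman_norm_def SUP_le_iff)
qed

section \<open>Bang's theorem\<close>

text \<open>Bang's argument: if all scaled derivatives \<open>\<bar>d n\<bar> / (exp n * W n)\<close> at a point are at most
  \<open>exp (- (k + 1))\<close>, then within distance \<open>W k / (exp 1 * W (k + 1))\<close> of it they are at most \<open>exp (- k)\<close>.\<close>

lemma bang_step:
  fixes d :: "nat \<Rightarrow> real \<Rightarrow> real" and W :: "nat \<Rightarrow> real"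
  assumes d: "\<And>n x. (d n has_real_derivative d (Suc n) x) (at x)"
    and W: "\<And>n. 0 < W n"
    and ratio: "\<And>i. i \<le> k \<Longrightarrow> W (Suc i) \<le> r * W i"
    and bound: "\<And>n x. \<bar>d n x\<bar> \<le> W n"
    and x: "\<And>n. \<bar>d n x\<bar> \<le> exp (real n - real (Suc k)) * W n"
    and h: "\<bar>h\<bar> * exp 1 * r \<le> 1"
  shows "\<bar>d n (x + h)\<bar> \<le> exp (real n - real k) * W n"
proof (cases "n \<le> k")
  case False
  \<comment> \<open>Above index \<open>k\<close> the claim is weaker than the global bound.\<close>
  then have "1 * W n \<le> exp (real n - real k) * W n"
    using W[of n] by (intro mult_right_mono) auto
  then show ?thesis using bound[of n "x + h"] by simp
next
  case True
  \<comment> \<open>Taylor's formula at \<open>x\<close> is taken up to the derivative of order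
    \<open>Suc k\<close>, where the factor \<open>exp (real (n + j) - real (Suc k))\<close> has
    become 1: the remainder, evaluated away from \<open>x\<close>, then needs only the global
    bound.\<close>
  define j where "j = Suc k - n"
  have nj: "n + j = Suc k" using True by (simp add: j_def)
  have "0 < W (Suc 0)" using W by blast
  also have "W (Suc 0) \<le> r * W 0" using ratio by simp
  finally have r: "0 < r" using W[of 0] by (simp add: zero_less_mult_iff)
  have Wr: "W (n + m) \<le> r ^ m * W n" if "m \<le> j" for m
    using that
  proof (induction m)
    case (Suc m)
    have "W (n + Suc m) \<le> r * W (n + m)"
      using ratio[of "n + m"] Suc.prems nj by simp
    also have "\<dots> \<le> r * (r ^ m * W n)"
      using Suc r by (intro mult_left_mono) auto
    finally show ?case by (simp add: mult_ac)
  qed simp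
  define y where "y = exp 1 * r * \<bar>h\<bar>"
  have y: "0 \<le> y" "y \<le> 1" using h r by (auto simp: y_def mult_ac)
  define c where "c = exp (real n - real (Suc k)) * W n"
  have c: "0 \<le> c" using W[of n] by (simp add: c_def)
  have summand: "\<bar>z\<bar> / fact m * \<bar>h\<bar> ^ m \<le> c * (y ^ m / fact m)"
    if "m \<le> j" "\<bar>z\<bar> \<le> exp (real (n + m) - real (Suc k)) * W (n + m)" for z m
  proof -
    have "\<bar>z\<bar> \<le> exp (real (n + m) - real (Suc k)) * (r ^ m * W n)"
      by (rule order_trans[OF that(2) mult_left_mono[OF Wr[OF that(1)]]]) simp
    also have "exp (real (n + m) - real (Suc k)) = exp (real n - real (Suc k)) * exp 1 ^ m"
      by (simp add: exp_of_nat_mult[symmetric] exp_add[symmetric])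
    finally have "\<bar>z\<bar> \<le> c * (exp 1 * r) ^ m"
      by (simp add: c_def power_mult_distrib mult_ac)
    then have "\<bar>z\<bar> * \<bar>h\<bar> ^ m \<le> c * (exp 1 * r) ^ m * \<bar>h\<bar> ^ m"
      by (intro mult_right_mono) auto
    then show ?thesis
      by (simp add: y_def power_mult_distrib divide_right_mono mult_ac)
  qed
  have "\<forall>m s. ((\<lambda>s. d (n + m) (x + s)) has_real_derivative d (n + Suc m) (x + s)) (at s)"
  proof (intro allI)
    fix m s
    have "((\<lambda>s. d (n + m) (s + x)) has_real_derivative d (n + Suc m) (s + x)) (at s)"
      using d[of "n + m" "s + x"] by (simp add: DERIV_shift)
    then show "((\<lambda>s. d (n + m) (x + s)) has_real_derivative d (n + Suc m) (x + s)) (at s)"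
      by (simp add: add.commute)
  qed
  then obtain t where t: "d n (x + h) =
      (\<Sum>m<j. d (n + m) x / fact m * h ^ m) + d (n + j) (x + t) / fact j * h ^ j"
    using Maclaurin_all_le[of "\<lambda>m s. d (n + m) (x + s)" "\<lambda>s. d n (x + s)" h j] by auto
  have "\<bar>d n (x + h)\<bar> \<le> (\<Sum>m<j. \<bar>d (n + m) x\<bar> / fact m * \<bar>h\<bar> ^ m) + \<bar>d (n + j) (x + t)\<bar> / fact j * \<bar>h\<bar> ^ j"
    unfolding t
    by (rule order_trans[OF abs_triangle_ineq])
      (intro add_mono order_trans[OF sum_abs] sum_mono; simp add: abs_mult power_abs)
  also have "\<dots> \<le> (\<Sum>m<j. c * (y ^ m / fact m)) + c * (y ^ j / fact j)"
    by (intro add_mono sum_mono summand x) (use bound nj in auto)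
  also have "\<dots> = c * (\<Sum>m<Suc j. y ^ m / fact m)"
    by (simp add: sum_distrib_left algebra_simps)
  \<comment> \<open>The Taylor sum is a partial sum of the exponential series; the resulting factor
    \<open>exp 1\<close> is the loss from \<open>Suc k\<close> to \<open>k\<close>.\<close>
  also have "(\<Sum>m<Suc j. y ^ m / fact m) \<le> exp y"
    using sum_le_suminf[OF summable_exp_generic[of y], of "{..<Suc j}"] y
    by (simp add: exp_def field_simps)
  also have "exp y \<le> exp 1" using y by simp
  finally have "\<bar>d n (x + h)\<bar> \<le> c * exp 1"
    using c by (simp add: mult_left_mono)
  also have "\<dots> = exp (real n - real k) * W n"
    by (simp add: c_def exp_add[symmetric])
  finally show ?thesis .
qed

text \<open>The sum of the step lengths \<open>u i / exp 1\<close> diverges, even from a late index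
  \<open>k\<close> on. So every \<open>x\<close> is reached from the flat point \<open>a\<close> by
  finitely many steps with indices at least \<open>k\<close>, and the value at \<open>x\<close>
  still carries the factor \<open>exp (- real k)\<close>; here \<open>k\<close> is
  arbitrary.\<close>

lemma bang_quasianalytic:
  fixes d :: "nat \<Rightarrow> real \<Rightarrow> real" and W :: "nat \<Rightarrow> real"
  assumes d: "\<And>n x. (d n has_real_derivative d (Suc n) x) (at x)"
    and W: "\<And>n. 0 < W n"
    and decr: "decseq (\<lambda>n. W n / W (Suc n))"
    and bound: "\<And>n x. \<bar>d n x\<bar> \<le> W n"
    and flat: "\<And>n. d n a = 0"
    and div: "\<not> summable (\<lambda>n. W n / W (Suc n))"
  shows "d 0 x = 0"
proof -
  define u where "u = (\<lambda>n. W n / W (Suc n))"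
  have u: "0 < u n" for n using W by (simp add: u_def)
  \<comment> \<open>The induction runs downward from \<open>m\<close>, where the range of
    \<open>x\<close> shrinks to the flat point \<open>a\<close>; each lower index extends the range
    by one application of \<open>bang_step\<close>.\<close>
  have claim: "\<bar>d n x\<bar> \<le> exp (real n - real k) * W n"
    if "k \<le> m" "\<bar>x - a\<bar> \<le> (\<Sum>i=k..<m. u i / exp 1)" for k m n x
    using that
  proof (induction k arbitrary: x n rule: inc_induct)
    case base
    then show ?case using flat[of n] W[of n] by (simp add: less_imp_le)
  next
    case (step k)
    \<comment> \<open>The point \<open>x - h\<close> is nearer to \<open>a\<close> than
      \<open>x\<close> by \<open>u k / exp 1\<close>, or is \<open>a\<close> itself if
      \<open>x\<close> is already that close.\<close>
    define h where "h = (if \<bar>x - a\<bar> \<le> u k / exp 1 then x - a else sgn (x - a) * (u k / exp 1))"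
    have uk: "0 < u k / exp 1" using u by simp
    have "sum (\<lambda>i. u i / exp 1) {Suc k..<m} \<ge> 0"
      using u by (intro sum_nonneg) (simp add: less_imp_le)
    then have "\<bar>(x - h) - a\<bar> \<le> (\<Sum>i=Suc k..<m. u i / exp 1)" and h: "\<bar>h\<bar> \<le> u k / exp 1"
      using step.prems step.hyps uk
      by (auto simp: h_def sum.atLeast_Suc_lessThan[of k m] sgn_if abs_if split: if_splits)
    then have *: "\<bar>d n (x - h)\<bar> \<le> exp (real n - real (Suc k)) * W n" for n
      using step.IH by blast
    have "\<bar>d n ((x - h) + h)\<bar> \<le> exp (real n - real k) * W n"
    proof (rule bang_step[where r = "1 / u k", OF d W _ bound *])
      \<comment> \<open>Since the ratios \<open>u\<close> decrease, \<open>1 / u k\<close> is the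
        largest growth factor of \<open>W\<close> up to index \<open>k\<close>.\<close>
      show "W (Suc i) \<le> 1 / u k * W i" if "i \<le> k" for i
      proof -
        have "u k \<le> u i" using decseqD[OF decr that] by (simp add: u_def)
        then show ?thesis using W[of "Suc i"] u[of k]
          by (simp add: u_def[THEN fun_cong, of i] pos_le_divide_eq mult.commute)
      qed
      have "\<bar>h\<bar> * exp 1 \<le> u k" using h by (simp add: field_simps)
      then show "\<bar>h\<bar> * exp 1 * (1 / u k) \<le> 1" using u[of k] by simp
    qed
    then show ?case by simp
  qed
  have "\<bar>d 0 x\<bar> \<le> exp (- real k) * W 0" for k
  proof -
    have "\<exists>m\<ge>k. \<bar>x - a\<bar> \<le> (\<Sum>i=k..<m. u i / exp 1)"
    proof (rule ccontr)
      assume *: "\<not> ?thesis"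
      have "(\<Sum>i<m. u (i + k) / exp 1) \<le> \<bar>x - a\<bar>" for m
      proof -
        have "(\<Sum>i<m. u (i + k) / exp 1) = (\<Sum>i=k..<k + m. u i / exp 1)"
          using sum.shift_bounds_nat_ivl[of "\<lambda>i. u i / exp 1" 0 k m]
          by (simp add: lessThan_atLeast0 add.commute)
        also have "\<dots> \<le> \<bar>x - a\<bar>" using * by (meson le_add1 linear)
        finally show ?thesis .
      qed
      then have "summable (\<lambda>i. u (i + k) / exp 1)"
        using u by (intro summableI_nonneg_bounded) (auto simp: less_imp_le)
      then have "summable (\<lambda>i. u i)"
        using summable_iff_shift[of "\<lambda>i. u i / exp 1" k] summable_mult[of "\<lambda>i. u i / exp 1" "exp 1"]
        by simp
      then show False using div by (simp add: u_def)
    qed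
    then show ?thesis using claim[of k _ x 0] by auto
  qed
  moreover have "(\<lambda>k. exp (- real k) * W 0) \<longlonglongrightarrow> 0 * W 0"
    by (intro tendsto_mult tendsto_const filterlim_compose[OF exp_at_bot]
        filterlim_compose[OF filterlim_uminus_at_bot_at_top filterlim_real_sequentially])
  ultimately have "\<bar>d 0 x\<bar> \<le> 0 * W 0"
    by (intro LIMSEQ_le_const) auto
  then show ?thesis by simp
qed

section \<open>Infinite convolutions of uniform densities\<close>

text \<open>The density of a sum of uniform variables is not available as a starting point, so one works with
  its second antiderivative: the limit \<open>E\<close> of iterated averages of \<open>max 0\<close>, which is nonexpansive.\<close>

definition avg :: "real \<Rightarrow> (real \<Rightarrow> real) \<Rightarrow> real \<Rightarrow> real" where
  "avg a h x = integral {0..1} (\<lambda>t. h (x - a * t))"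

definition diff_quot :: "real \<Rightarrow> (real \<Rightarrow> real) \<Rightarrow> real \<Rightarrow> real" where
  "diff_quot b h x = (h x - h (x - b)) / b"

text \<open>In terms of an antiderivative \<open>H\<close> of \<open>h\<close>, the average is the
  difference quotient of \<open>H\<close> with step \<open>a\<close>.\<close>

lemma avg_has_real_derivative:
  assumes a: "0 < a" and h: "continuous_on UNIV h"
  shows "(avg a h has_real_derivative diff_quot a h x) (at x)"
proof -
  have "\<exists>H. \<forall>x::real. - \<infinity> < ereal x \<longrightarrow> ereal x < \<infinity> \<longrightarrow> (H has_vector_derivative h x) (at x)"
    using h by (intro einterval_antiderivative) (auto simp: continuous_on_eq_continuous_at)
  then obtain H where "\<And>x. (H has_vector_derivative h x) (at x)"
    by auto
  then have H: "(H has_real_derivative h x) (at x)" for x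
    by (simp add: has_real_derivative_iff_has_vector_derivative)
  have "avg a h = (\<lambda>x. (H x - H (x - a)) / a)"
  proof
    fix x
    have "((\<lambda>t. h (x - a * t)) has_integral (- H (x - a * 1) / a - (- H (x - a * 0) / a))) {0..1}"
      using a
      by (intro fundamental_theorem_of_calculus)
        (auto simp flip: has_real_derivative_iff_has_vector_derivative
          intro!: derivative_eq_intros DERIV_chain2[OF H])
    then show "avg a h x = (H x - H (x - a)) / a"
      by (simp add: avg_def integral_unique diff_divide_distrib)
  qed
  moreover have "((\<lambda>x. (H x - H (x - a)) / a) has_real_derivative diff_quot a h x) (at x)"
    using a unfolding diff_quot_def
    by (auto intro!: derivative_eq_intros H DERIV_chain2[OF H])
  ultimately show ?thesis by simp
qed

text \<open>Two functions, two points and an offset \<open>c\<close> let this one estimate serve for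
  nonexpansiveness, vanishing on the left, translation on the right and the error of the
  limit.\<close>

lemma avg_dist_le:
  assumes "continuous_on UNIV f" "continuous_on UNIV g"
    and "\<And>t. 0 \<le> t \<Longrightarrow> t \<le> 1 \<Longrightarrow> \<bar>f (x - a * t) - g (y - a * t) - c\<bar> \<le> B"
  shows "\<bar>avg a f x - avg a g y - c\<bar> \<le> B"
proof -
  have int: "(\<lambda>t. h (z - a * t)) integrable_on {0..1}" if "continuous_on UNIV h" for h :: "real \<Rightarrow> real" and z
    by (rule integrable_continuous_interval, rule continuous_on_compose2[OF that])
      (auto intro!: continuous_intros)
  have *: "((\<lambda>t. f (x - a * t) - g (y - a * t) - c) has_integral avg a f x - avg a g y - c) {0..1}"
    using has_integral_const_real[of c 0 1]
    by (auto intro!: has_integral_diff integrable_integral int assms(1,2) simp: avg_def)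
  have "0 \<le> B" using assms(3)[of 0] by (meson abs_ge_zero order_refl order_trans zero_le_one)
  then have "norm (avg a f x - avg a g y - c) \<le> B * measure lborel {0..1::real}"
    by (intro has_integral_bound_real[OF _ finite.emptyI *]) (use assms(3) in auto)
  then show ?thesis by simp
qed

lemma continuous_on_nonexpansive:
  fixes f :: "real \<Rightarrow> real"
  assumes "\<And>x y. \<bar>f x - f y\<bar> \<le> \<bar>x - y\<bar>"
  shows "continuous_on S f"
proof -
  have "1-lipschitz_on S f"
    using assms by (intro lipschitz_onI) (auto simp: dist_real_def)
  then show ?thesis by (rule lipschitz_on_continuous_on)
qed

text \<open>The ramp \<open>max 0\<close> convolved with the uniform densities on
  \<open>[0, a m]\<close> to \<open>[0, a (m + d - 1)]\<close>. The outermost average has the lowest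
  index, so stripping it by differentiation leaves the same kind of object started at
  \<open>Suc m\<close>.\<close>

fun iter_avg :: "(nat \<Rightarrow> real) \<Rightarrow> nat \<Rightarrow> nat \<Rightarrow> real \<Rightarrow> real" where
  "iter_avg a 0 m = max 0"
| "iter_avg a (Suc d) m = avg (a m) (iter_avg a d (Suc m))"

lemma iter_avg_nonexpansive: "\<bar>iter_avg a d m x - iter_avg a d m y\<bar> \<le> \<bar>x - y\<bar>"
proof (induction d arbitrary: m x y)
  case (Suc d)
  have c: "continuous_on UNIV (iter_avg a d (Suc m))"
    by (rule continuous_on_nonexpansive[OF Suc])
  show ?case
    using avg_dist_le[OF c c, of x "a m" y 0 "\<bar>x - y\<bar>"] Suc[of "Suc m"]
    by (simp add: order_trans[OF Suc])
qed (auto simp: max_def)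

lemma continuous_on_iter_avg: "continuous_on S (iter_avg a d m)"
  by (rule continuous_on_nonexpansive[OF iter_avg_nonexpansive])

lemma iter_avg_eq_0:
  assumes "\<And>k. 0 < a k" "x \<le> 0"
  shows "iter_avg a d m x = 0"
  using assms(2)
proof (induction d arbitrary: m x)
  case (Suc d)
  have "x - a m * t \<le> 0" if "0 \<le> t" for t
    using Suc.prems assms(1)[of m] that by (meson diff_le_0_iff_le less_imp_le mult_nonneg_nonneg order_trans)
  then have "\<bar>avg (a m) (iter_avg a d (Suc m)) x - avg (a m) (\<lambda>_. 0) x - 0\<bar> \<le> 0"
    by (intro avg_dist_le continuous_on_iter_avg continuous_on_const) (simp add: Suc.IH)
  then show ?case
    by (simp add: avg_def)
qed simp

text \<open>To the right of all shifts only the linear branch of the ramp is seen, and averages keep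
  slope 1.\<close>

lemma iter_avg_translation:
  assumes "\<And>k. 0 < a k" "(\<Sum>k<d. a (m + k)) \<le> x" "(\<Sum>k<d. a (m + k)) \<le> y"
  shows "iter_avg a d m x - iter_avg a d m y = x - y"
  using assms(2,3)
proof (induction d arbitrary: m x y)
  case (Suc d)
  have "(\<Sum>k<d. a (Suc m + k)) \<le> z - a m * t" if "(\<Sum>k<Suc d. a (m + k)) \<le> z" "t \<le> 1" for z t
    using that(1) mult_left_mono[OF that(2) less_imp_le[OF assms(1)], of m]
    by (simp add: sum.lessThan_Suc_shift del: sum.lessThan_Suc)
  then have "iter_avg a d (Suc m) (x - a m * t) - iter_avg a d (Suc m) (y - a m * t) = x - y"
    if "t \<le> 1" for t
    using that Suc.prems by (subst Suc.IH) auto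
  then show ?case
    using avg_dist_le[OF continuous_on_iter_avg continuous_on_iter_avg,
        of a d "Suc m" x "a m" a d "Suc m" y "x - y" 0] by simp
qed simp

text \<open>The additional average enters innermost, where it moves the ramp by at most its width;
  the outer averages do not enlarge this error.\<close>

lemma iter_avg_step:
  assumes "\<And>k. 0 < a k"
  shows "\<bar>iter_avg a (Suc d) m x - iter_avg a d m x\<bar> \<le> a (m + d)"
proof (induction d arbitrary: m x)
  case 0
  have "\<bar>max 0 (x - a m * t) - max 0 x - 0\<bar> \<le> a m" if "0 \<le> t" "t \<le> 1" for t
  proof -
    have "\<bar>a m * t\<bar> \<le> a m" using that assms[of m] by (simp add: abs_mult)
    then show ?thesis by linarith
  qed
  moreover have "continuous_on UNIV (max (0::real))"
    by (intro continuous_on_max continuous_on_const continuous_on_id)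
  ultimately have "\<bar>avg (a m) (max 0) x - avg (a m) (\<lambda>_. max 0 x) x - 0\<bar> \<le> a m"
    by (intro avg_dist_le continuous_on_const)
  then show ?case by (simp add: avg_def)
next
  case (Suc d)
  show ?case
    using avg_dist_le[OF continuous_on_iter_avg continuous_on_iter_avg,
        of a "Suc d" "Suc m" x "a m" a d "Suc m" x 0 "a (Suc m + d)"] Suc[of "Suc m"] by simp
qed

text \<open>By \<open>iter_avg_step\<close> the increments in \<open>d\<close> are dominated by
  \<open>a\<close>, so the limit exists and its error is a tail of the series of \<open>a\<close>,
  uniformly in \<open>x\<close>.\<close>

lemma iter_avg_limit:
  assumes a: "\<And>k. 0 < a k" and summ: "summable a"
  obtains E where "\<And>m x y. \<bar>E m x - E m y\<bar> \<le> \<bar>x - y\<bar>"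
    and "\<And>m x. x \<le> 0 \<Longrightarrow> E m x = 0"
    and "\<And>m x y. (\<Sum>k. a (m + k)) \<le> x \<Longrightarrow> (\<Sum>k. a (m + k)) \<le> y \<Longrightarrow> E m x - E m y = x - y"
    and "\<And>m x. (E m has_real_derivative diff_quot (a m) (E (Suc m)) x) (at x)"
proof
  define E where "E m x = lim (\<lambda>d. iter_avg a d m x)" for m x
  have summ': "summable (\<lambda>k. a (m + k))" for m
    using summ by (simp add: summable_iff_shift add.commute[of m])
  define R where "R m = (\<Sum>k. a (m + k))" for m
  have lim: "(\<lambda>d. iter_avg a d m x) \<longlonglongrightarrow> E m x"
    and err: "\<bar>E m x - iter_avg a d m x\<bar> \<le> R (m + d)" for m x d
  proof -
    define s where "s d = iter_avg a (Suc d) m x - iter_avg a d m x" for d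
    have s: "\<bar>s d\<bar> \<le> a (m + d)" for d
      using iter_avg_step[OF a] by (simp add: s_def)
    have "summable s"
      by (rule summable_comparison_test[OF _ summ'[of m]]) (use s in auto)
    then have "(\<lambda>d. iter_avg a 0 m x + (\<Sum>k<d. s k)) \<longlonglongrightarrow> iter_avg a 0 m x + suminf s"
      by (intro tendsto_intros summable_LIMSEQ)
    moreover have "iter_avg a 0 m x + (\<Sum>k<d. s k) = iter_avg a d m x" for d
      unfolding s_def by (subst sum_lessThan_telescope) simp
    ultimately have lim': "(\<lambda>d. iter_avg a d m x) \<longlonglongrightarrow> iter_avg a 0 m x + suminf s"
      by simp
    then have Eeq: "E m x = iter_avg a 0 m x + suminf s"
      unfolding E_def by (rule limI)
    show "(\<lambda>d. iter_avg a d m x) \<longlonglongrightarrow> E m x"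
      using lim' Eeq by simp
    have "E m x - iter_avg a d m x = (\<Sum>k. s (k + d))"
      using suminf_minus_initial_segment[OF \<open>summable s\<close>, of d]
      by (simp only: Eeq \<open>\<And>d. iter_avg a 0 m x + (\<Sum>k<d. s k) = iter_avg a d m x\<close>[of d, symmetric])
    also have "\<bar>\<dots>\<bar> \<le> (\<Sum>k. a (m + d + k))"
    proof -
      have "norm (s (k + d)) \<le> a (m + d + k)" for k
        using s[of "k + d"] by (simp add: ac_simps)
      then show ?thesis
        using norm_suminf_le[of "\<lambda>k. s (k + d)" "\<lambda>k. a (m + d + k)"] summ'[of "m + d"] by simp
    qed
    finally show "\<bar>E m x - iter_avg a d m x\<bar> \<le> R (m + d)"
      by (simp add: R_def)
  qed
  have R0: "(\<lambda>d. R (m + d)) \<longlonglongrightarrow> 0" for m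
  proof -
    have "(\<lambda>d. suminf (\<lambda>k. a (k + d))) \<longlonglongrightarrow> 0"
      by (rule suminf_exist_split2[OF summ])
    then have "(\<lambda>d. R (d + m)) \<longlonglongrightarrow> 0"
      by (intro LIMSEQ_ignore_initial_segment) (simp add: R_def add.commute)
    then show ?thesis by (simp add: add.commute)
  qed
  show ne: "\<bar>E m x - E m y\<bar> \<le> \<bar>x - y\<bar>" for m x y
    by (rule LIMSEQ_le_const2[OF tendsto_rabs[OF tendsto_diff[OF lim lim]]])
      (use iter_avg_nonexpansive in auto)
  show "E m x = 0" if "x \<le> 0" for m x
    using lim[of m x] iter_avg_eq_0[OF a that] by (simp add: LIMSEQ_const_iff)
  show "E m x - E m y = x - y" if "(\<Sum>k. a (m + k)) \<le> x" "(\<Sum>k. a (m + k)) \<le> y" for m x y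
  proof -
    have le: "(\<Sum>k<d. a (m + k)) \<le> (\<Sum>k. a (m + k))" for d
      by (rule sum_le_suminf[OF summ']) (use a in \<open>auto simp: less_imp_le\<close>)
    have "iter_avg a d m x - iter_avg a d m y = x - y" for d
      by (rule iter_avg_translation[OF a]) (use le[of d] that in auto)
    then show ?thesis
      using tendsto_diff[OF lim[of m x] lim[of m y]] by (simp add: LIMSEQ_const_iff)
  qed
  have cont: "continuous_on UNIV (E m)" for m
    by (rule continuous_on_nonexpansive[OF ne])
  \<comment> \<open>The uniform error bound lets the recursion of \<open>iter_avg\<close> survive
    the limit; the derivative of \<open>E m\<close> is then that of an average.\<close>
  have "E m = avg (a m) (E (Suc m))" for m
  proof
    fix x
    have "\<bar>avg (a m) (E (Suc m)) x - iter_avg a (Suc d) m x - 0\<bar> \<le> R (Suc m + d)" for d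
      unfolding iter_avg.simps
      by (rule avg_dist_le[OF cont continuous_on_iter_avg]) (use err[of "Suc m" _ d] in simp)
    then have "(\<lambda>d. avg (a m) (E (Suc m)) x - iter_avg a (Suc d) m x) \<longlonglongrightarrow> 0"
      by (intro Lim_null_comparison[OF _ R0[of "Suc m"]]) (auto simp del: iter_avg.simps)
    moreover have "(\<lambda>d. avg (a m) (E (Suc m)) x - iter_avg a (Suc d) m x)
        \<longlonglongrightarrow> avg (a m) (E (Suc m)) x - E m x"
      by (intro tendsto_intros LIMSEQ_Suc lim)
    ultimately show "E m x = avg (a m) (E (Suc m)) x"
      using LIMSEQ_unique by fastforce
  qed
  then show "(E m has_real_derivative diff_quot (a m) (E (Suc m)) x) (at x)" for m x
    using avg_has_real_derivative[OF a[of m] cont[of "Suc m"]] by metis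
qed

text \<open>The \<open>n\<close>-th derivative of \<open>E 0\<close> is \<open>iter_diff_quot a n (E n)\<close>, and the bump is the second
  derivative of \<open>E 0\<close>.\<close>

primrec iter_diff_quot :: "(nat \<Rightarrow> real) \<Rightarrow> nat \<Rightarrow> (real \<Rightarrow> real) \<Rightarrow> real \<Rightarrow> real" where
  "iter_diff_quot a 0 h = h"
| "iter_diff_quot a (Suc n) h = iter_diff_quot a n (diff_quot (a n) h)"

lemma DERIV_iter_diff_quot:
  assumes "\<And>k. 0 < a k" "\<And>x. (h has_real_derivative h' x) (at x)"
  shows "(iter_diff_quot a n h has_real_derivative iter_diff_quot a n h' x) (at x)"
  using assms(2)
proof (induction n arbitrary: h h')
  case (Suc n)
  have "(diff_quot (a n) h has_real_derivative diff_quot (a n) h' x) (at x)" for x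
    unfolding diff_quot_def using assms(1)[of n]
    by (auto intro!: derivative_eq_intros Suc.prems DERIV_chain2[OF Suc.prems])
  then show ?case by (simp add: Suc.IH)
qed simp

lemma iter_diff_quot_bound:
  assumes "\<And>k. 0 < a k" "\<And>x. \<bar>h x\<bar> \<le> B"
  shows "\<bar>iter_diff_quot a n h x\<bar> \<le> B * (\<Prod>k<n. 2 / a k)"
  using assms(2)
proof (induction n arbitrary: h B)
  case (Suc n)
  have "\<bar>diff_quot (a n) h x\<bar> \<le> B * (2 / a n)" for x
  proof -
    have "\<bar>h x - h (x - a n)\<bar> \<le> 2 * B"
      using Suc.prems[of x] Suc.prems[of "x - a n"] by linarith
    then show ?thesis
      using assms(1)[of n] by (simp add: diff_quot_def divide_right_mono mult.commute)
  qed
  from Suc.IH[OF this] show ?case by (simp add: mult_ac)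
qed simp

lemma iter_diff_quot_eq_0:
  assumes "\<And>k. 0 < a k" "\<And>x. x \<le> 0 \<Longrightarrow> h x = 0" "x \<le> 0"
  shows "iter_diff_quot a n h x = 0"
  using assms(2)
proof (induction n arbitrary: h)
  case (Suc n)
  have "diff_quot (a n) h x = 0" if "x \<le> 0" for x
    using Suc.prems[of x] Suc.prems[of "x - a n"] that assms(1)[of n] by (simp add: diff_quot_def)
  then show ?case by (simp add: Suc.IH)
qed (use assms in simp)

section \<open>The bump: support, sup norms and integrals of \<open>p\<close>-th powers\<close>

lemma powr_add_le:
  fixes x y p :: real
  assumes "0 < p" "p < 1" "0 \<le> x" "0 \<le> y"
  shows "(x + y) powr p \<le> x powr p + y powr p"
proof (cases "x + y = 0")
  case False
  then have s: "0 < x + y" using assms by linarith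
  \<comment> \<open>After division by \<open>x + y\<close> both terms lie in the unit interval,
    where raising to a power \<open>p < 1\<close> only enlarges.\<close>
  have *: "u \<le> u powr p" if "0 \<le> u" "u \<le> 1" for u
    using powr_mono'[of p 1 u] that assms by (cases "u = 0") auto
  have "1 = x / (x + y) + y / (x + y)"
    using s by (simp add: add_divide_distrib[symmetric])
  also have "\<dots> \<le> (x / (x + y)) powr p + (y / (x + y)) powr p"
    using assms s by (intro add_mono *) auto
  also have "\<dots> = (x powr p + y powr p) / (x + y) powr p"
    using assms s by (simp add: powr_divide add_divide_distrib)
  finally show ?thesis using s by (simp add: pos_le_divide_eq)
qed (use assms in simp)

text \<open>The factor 2 comes from subadditivity of \<open>p\<close>-th powers and translation
  invariance of the integral.\<close>

lemma nn_integral_diff_quot_le: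
  assumes p: "0 < p" "p < 1" and b: "0 < b" and h: "continuous_on UNIV h"
  shows "(\<integral>\<^sup>+ x. ennreal (\<bar>diff_quot b h x\<bar> powr p) \<partial>lborel)
    \<le> ennreal (2 * b powr - p) * (\<integral>\<^sup>+ x. ennreal (\<bar>h x\<bar> powr p) \<partial>lborel)"
proof -
  have [measurable]: "h \<in> borel_measurable borel"
    using h by (rule borel_measurable_continuous_onI)
  define I where "I = (\<integral>\<^sup>+ x. ennreal (\<bar>h x\<bar> powr p) \<partial>lborel)"
  have shift: "I = (\<integral>\<^sup>+ x. ennreal (\<bar>h (x - b)\<bar> powr p) \<partial>lborel)"
    unfolding I_def
    using nn_integral_real_affine[of "\<lambda>x. ennreal (\<bar>h x\<bar> powr p)" 1 "- b"] by (simp add: add.commute)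
  have "\<bar>diff_quot b h x\<bar> powr p \<le> b powr - p * (\<bar>h x\<bar> powr p + \<bar>h (x - b)\<bar> powr p)" for x
  proof -
    have "\<bar>diff_quot b h x\<bar> \<le> (\<bar>h x\<bar> + \<bar>h (x - b)\<bar>) / b"
      using b by (simp add: diff_quot_def divide_right_mono abs_triangle_ineq4)
    then have "\<bar>diff_quot b h x\<bar> powr p \<le> ((\<bar>h x\<bar> + \<bar>h (x - b)\<bar>) / b) powr p"
      using p by (intro powr_mono2) auto
    also have "\<dots> = b powr - p * (\<bar>h x\<bar> + \<bar>h (x - b)\<bar>) powr p"
      using b by (simp add: powr_divide powr_minus_divide)
    finally show ?thesis
      using powr_add_le[OF p, of "\<bar>h x\<bar>" "\<bar>h (x - b)\<bar>"] b
      by (smt (verit) abs_ge_zero mult_left_mono powr_ge_zero)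
  qed
  then have "(\<integral>\<^sup>+ x. ennreal (\<bar>diff_quot b h x\<bar> powr p) \<partial>lborel)
      \<le> (\<integral>\<^sup>+ x. ennreal (b powr - p) * (ennreal (\<bar>h x\<bar> powr p) + ennreal (\<bar>h (x - b)\<bar> powr p)) \<partial>lborel)"
    by (intro nn_integral_mono) (simp add: ennreal_mult[symmetric] ennreal_plus[symmetric] ennreal_leI del: ennreal_plus)
  also have "\<dots> = ennreal (b powr - p) * (I + I)"
    by (simp add: nn_integral_cmult nn_integral_add shift[symmetric] I_def[symmetric])
  also have "\<dots> = ennreal (2 * b powr - p) * I"
    by (simp add: mult_2[symmetric] ennreal_mult mult_ac)
  finally show ?thesis by (simp add: I_def)
qed

lemma nn_integral_iter_diff_quot_le:
  assumes p: "0 < p" "p < 1" and a: "\<And>k. 0 < a k" and h: "continuous_on UNIV h"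
  shows "(\<integral>\<^sup>+ x. ennreal (\<bar>iter_diff_quot a n h x\<bar> powr p) \<partial>lborel)
    \<le> ennreal (2 ^ n * (\<Prod>k<n. a k) powr - p) * (\<integral>\<^sup>+ x. ennreal (\<bar>h x\<bar> powr p) \<partial>lborel)"
  using h
proof (induction n arbitrary: h)
  case (Suc n)
  have "continuous_on UNIV (diff_quot (a n) h)"
    unfolding diff_quot_def using a[of n]
    by (intro continuous_intros continuous_on_compose2[OF Suc.prems]) (auto simp: Suc.prems)
  note Suc.IH[OF this]
  also have "ennreal (2 ^ n * (\<Prod>k<n. a k) powr - p) * (\<integral>\<^sup>+ x. ennreal (\<bar>diff_quot (a n) h x\<bar> powr p) \<partial>lborel)
      \<le> ennreal (2 ^ n * (\<Prod>k<n. a k) powr - p) *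
        (ennreal (2 * a n powr - p) * (\<integral>\<^sup>+ x. ennreal (\<bar>h x\<bar> powr p) \<partial>lborel))"
    by (intro mult_left_mono nn_integral_diff_quot_le p a Suc.prems) auto
  also have "\<dots> = ennreal ((2 ^ n * (\<Prod>k<n. a k) powr - p) * (2 * a n powr - p)) *
      (\<integral>\<^sup>+ x. ennreal (\<bar>h x\<bar> powr p) \<partial>lborel)"
    by (subst ennreal_mult) (simp_all add: mult.assoc)
  also have "(2 ^ n * (\<Prod>k<n. a k) powr - p) * (2 * a n powr - p) = 2 ^ Suc n * (\<Prod>k<Suc n. a k) powr - p"
    using a by (simp add: powr_mult prod_nonneg less_imp_le)
  finally show ?case by simp
qed simp

text \<open>The \<open>n\<close>-th derivative of the bump consists of \<open>n\<close> difference
  quotients of one function \<open>g n\<close>, which is supported in an interval of length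
  \<open>\<Sum>k. a (n + k)\<close> and bounded by \<open>2 / a n\<close>. Each quotient costs
  \<open>2 / a k\<close> in the sup norm and \<open>2 * a k powr - p\<close> in the
  integral.\<close>

lemma bump_exists:
  assumes p: "0 < p" "p < 1" and a: "\<And>k. 0 < a k" and summ: "summable a"
  obtains D :: "nat \<Rightarrow> real \<Rightarrow> real"
  where "\<And>n x. (D n has_real_derivative D (Suc n) x) (at x)"
    and "\<And>n x. x \<le> 0 \<Longrightarrow> D n x = 0"
    and "D 0 \<noteq> (\<lambda>x. 0)"
    and "\<And>n x. \<bar>D n x\<bar> \<le> (\<Prod>k\<le>n. 2 / a k)"
    and "\<And>n. (\<integral>\<^sup>+ x. ennreal (\<bar>D n x\<bar> powr p) \<partial>lborel)
      \<le> ennreal (2 ^ n * 2 powr p * (\<Prod>k\<le>n. a k) powr - p * (\<Sum>k. a (n + k)))"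
proof -
  obtain E where ne: "\<And>m x y. \<bar>E m x - E m y\<bar> \<le> \<bar>x - y\<bar>"
    and E0: "\<And>m x. x \<le> 0 \<Longrightarrow> E m x = 0"
    and E1: "\<And>m x y. (\<Sum>k. a (m + k)) \<le> x \<Longrightarrow> (\<Sum>k. a (m + k)) \<le> y \<Longrightarrow> E m x - E m y = x - y"
    and dE: "\<And>m x. (E m has_real_derivative diff_quot (a m) (E (Suc m)) x) (at x)"
    using iter_avg_limit[OF a summ] by blast
  define G where "G n = iter_diff_quot a n (E n)" for n
  \<comment> \<open>This is the second derivative of \<open>E n\<close>. Two quotients are kept
    inside because \<open>E\<close> itself is unbounded: the first makes it bounded, the second
    makes it vanish on the right.\<close>
  define g where "g n = diff_quot (a n) (diff_quot (a (Suc n)) (E (Suc (Suc n))))" for n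
  have dG: "(G n has_real_derivative G (Suc n) x) (at x)" for n x
    unfolding G_def using DERIV_iter_diff_quot[OF a dE] by simp
  have Gg: "G (Suc (Suc n)) = iter_diff_quot a n (g n)" for n
    by (simp add: G_def g_def)
  have summ': "summable (\<lambda>k. a (m + k))" for m
    using summ by (simp add: summable_iff_shift add.commute[of m])
  have R: "(\<Sum>k. a (m + k)) = a m + (\<Sum>k. a (Suc m + k))" for m
    using suminf_split_head[OF summ'[of m]] by simp
  have R_nonneg: "0 \<le> (\<Sum>k. a (m + k))" for m
    using a by (intro suminf_nonneg summ') (simp add: less_imp_le)
  have quot_le: "\<bar>diff_quot (a (Suc n)) (E (Suc (Suc n))) x\<bar> \<le> 1" for n x
    using ne[of "Suc (Suc n)" x "x - a (Suc n)"] a[of "Suc n"]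
    by (simp add: diff_quot_def)
  have g_le: "\<bar>g n x\<bar> \<le> 2 / a n" for n x
    unfolding g_def diff_quot_def[of "a n"] using quot_le[of n x] quot_le[of n "x - a n"] a[of n]
    by (simp add: divide_right_mono)
  have g_left: "g n x = 0" if "x \<le> 0" for n x
    using iter_diff_quot_eq_0[of "\<lambda>k. a (n + k)" "E (Suc (Suc n))" x 2, OF a E0] that
    by (simp add: g_def numeral_2_eq_2)
  \<comment> \<open>Here \<open>E (Suc (Suc n))\<close> has slope 1, so the inner quotient is 1 at
    both points and the outer one vanishes.\<close>
  have g_right: "g n x = 0" if "(\<Sum>k. a (n + k)) \<le> x" for n x
  proof -
    have "diff_quot (a (Suc n)) (E (Suc (Suc n))) y = 1" if "(\<Sum>k. a (Suc n + k)) \<le> y" for y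
      using E1[of "Suc (Suc n)" y "y - a (Suc n)"] that R[of "Suc n"] a[of "Suc n"]
      by (simp add: diff_quot_def)
    then show ?thesis
      using that R[of n] a[of n] by (simp add: g_def diff_quot_def[of "a n"])
  qed
  have cont_g: "continuous_on UNIV (g n)" for n
  proof -
    have c: "continuous_on UNIV (E (Suc (Suc n)))"
      by (rule continuous_on_nonexpansive[OF ne])
    show ?thesis
      unfolding g_def diff_quot_def using a[of n] a[of "Suc n"]
      by (intro continuous_intros continuous_on_compose2[OF c]) (auto simp: c)
  qed
  show ?thesis
  proof
    show "(G (Suc (Suc n)) has_real_derivative G (Suc (Suc (Suc n))) x) (at x)" for n x
      by (rule dG)
    show "G (Suc (Suc n)) x = 0" if "x \<le> 0" for n x
      unfolding Gg using iter_diff_quot_eq_0[OF a g_left that] .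
    \<comment> \<open>\<open>G 1\<close>, the derivative of \<open>E 0\<close>, rises from 0 to 1
      across the support, so its own derivative is not identically zero.\<close>
    show "G (Suc (Suc 0)) \<noteq> (\<lambda>x. 0)"
    proof
      assume "G (Suc (Suc 0)) = (\<lambda>x. 0)"
      then have "(G 1 has_real_derivative 0) (at x)" for x
        using dG[of 1 x] by simp
      then have const: "G 1 x = G 1 0" for x
        using DERIV_isconst_all by blast
      have "G 1 0 = 0"
        using E0[of 0 1] E0[of "- a 0" 1] a[of 0] by (simp add: G_def diff_quot_def)
      moreover have "G 1 (\<Sum>k. a (0 + k)) = 1"
        using E1[of 1 "\<Sum>k. a (0 + k)" "(\<Sum>k. a (0 + k)) - a 0"] R[of 0] a[of 0]
        by (simp add: G_def diff_quot_def)
      ultimately show False using const[of "\<Sum>k. a (0 + k)"] by simp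
    qed
    show "\<bar>G (Suc (Suc n)) x\<bar> \<le> (\<Prod>k\<le>n. 2 / a k)" for n x
    proof -
      have "\<bar>G (Suc (Suc n)) x\<bar> \<le> 2 / a n * (\<Prod>k<n. 2 / a k)"
        unfolding Gg by (rule iter_diff_quot_bound[OF a g_le])
      then show ?thesis
        by (simp add: lessThan_Suc_atMost[symmetric] mult_ac)
    qed
    show "(\<integral>\<^sup>+ x. ennreal (\<bar>G (Suc (Suc n)) x\<bar> powr p) \<partial>lborel)
      \<le> ennreal (2 ^ n * 2 powr p * (\<Prod>k\<le>n. a k) powr - p * (\<Sum>k. a (n + k)))" for n
    proof -
      define R where "R = (\<Sum>k. a (n + k))"
      have "ennreal (\<bar>g n x\<bar> powr p) \<le> ennreal ((2 / a n) powr p) * indicator {0..R} x" for x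
      proof (cases "x \<in> {0..R}")
        case True
        then show ?thesis
          using g_le[of n x] p by (simp add: ennreal_leI powr_mono2)
      next
        case False
        then show ?thesis using g_left[of x n] g_right[of n x] by (force simp: R_def)
      qed
      then have "(\<integral>\<^sup>+ x. ennreal (\<bar>g n x\<bar> powr p) \<partial>lborel)
          \<le> (\<integral>\<^sup>+ x. ennreal ((2 / a n) powr p) * indicator {0..R} x \<partial>lborel)"
        by (intro nn_integral_mono)
      also have "\<dots> = ennreal ((2 / a n) powr p * R)"
        using R_nonneg[of n] by (simp add: nn_integral_cmult_indicator R_def ennreal_mult)
      finally have *: "(\<integral>\<^sup>+ x. ennreal (\<bar>g n x\<bar> powr p) \<partial>lborel) \<le> ennreal ((2 / a n) powr p * R)" .
      have "(\<integral>\<^sup>+ x. ennreal (\<bar>G (Suc (Suc n)) x\<bar> powr p) \<partial>lborel)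
          \<le> ennreal (2 ^ n * (\<Prod>k<n. a k) powr - p) * ennreal ((2 / a n) powr p * R)"
        unfolding Gg
        by (rule order_trans[OF nn_integral_iter_diff_quot_le[OF p a cont_g] mult_left_mono[OF *]]) simp
      also have "\<dots> = ennreal (2 ^ n * 2 powr p * (\<Prod>k\<le>n. a k) powr - p * R)"
        using a R_nonneg[of n]
        by (simp add: ennreal_mult[symmetric] R_def[symmetric] powr_mult powr_divide prod_nonneg less_imp_le
            lessThan_Suc_atMost[symmetric] powr_minus_divide mult_ac)
      finally show ?thesis by (simp add: R_def)
    qed
  qed
qed

section \<open>Sup norm bounds in the completion\<close>

text \<open>The integral of \<open>norm (g' x)\<close> bounds all increments of \<open>g\<close>. If
  \<open>norm (g x)\<close> exceeded \<open>B\<close>, then \<open>norm (g y)\<close> would stay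
  above a positive constant on the whole line, against the finite integral of its
  \<open>p\<close>-th power.\<close>

lemma norm_le_nn_integral_deriv:
  fixes g g' :: "real \<Rightarrow> complex"
  assumes deriv: "\<And>x. (g has_vector_derivative g' x) (at x)"
    and cont: "continuous_on UNIV g'"
    and p: "0 < p" and fin: "(\<integral>\<^sup>+ x. ennreal (norm (g x) powr p) \<partial>lborel) < \<infinity>"
    and B: "0 \<le> B" "(\<integral>\<^sup>+ x. ennreal (norm (g' x)) \<partial>lborel) \<le> ennreal B"
  shows "norm (g x) \<le> B"
proof (rule ccontr)
  have increment: "norm (g u - g v) \<le> B" if "v \<le> u" for u v
  proof -
    have g': "(g' has_integral (g u - g v)) {v..u}"
      by (rule fundamental_theorem_of_calculus[OF that has_vector_derivative_at_within[OF deriv]])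
    have int: "(\<lambda>x. norm (g' x)) integrable_on {v..u}"
      by (intro integrable_continuous_interval continuous_on_norm continuous_on_subset[OF cont]) simp
    have "norm (g u - g v) \<le> integral {v..u} (\<lambda>x. norm (g' x))"
      using integral_norm_bound_integral[OF has_integral_integrable[OF g'] int] integral_unique[OF g'] by simp
    also have "\<dots> \<le> B"
    proof -
      have "ennreal (integral {v..u} (\<lambda>x. norm (g' x))) =
          (\<integral>\<^sup>+ x. ennreal (norm (g' x)) * indicator {v..u} x \<partial>lborel)"
        using int by (intro nn_integral_has_integral_lebesgue'[symmetric] integrable_integral) auto
      also have "\<dots> \<le> (\<integral>\<^sup>+ x. ennreal (norm (g' x)) \<partial>lborel)"
        by (intro nn_integral_mono) (simp add: indicator_def)
      finally have "ennreal (integral {v..u} (\<lambda>x. norm (g' x))) \<le> ennreal B"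
        using B(2) by (rule order_trans)
      then show ?thesis using B(1) by (simp add: ennreal_le_iff)
    qed
    finally show ?thesis .
  qed
  assume "\<not> norm (g x) \<le> B"
  define c where "c = norm (g x) - B"
  have c: "0 < c" using \<open>\<not> norm (g x) \<le> B\<close> by (simp add: c_def)
  have "c \<le> norm (g y)" for y
  proof -
    have "norm (g x - g y) \<le> B"
      using increment[of x y] increment[of y x] by (metis linear norm_minus_commute)
    then show ?thesis
      using norm_triangle_ineq2[of "g x" "g y"] by (simp add: c_def)
  qed
  then have "(\<integral>\<^sup>+ y. ennreal (c powr p) \<partial>(lborel :: real measure)) \<le> (\<integral>\<^sup>+ y. ennreal (norm (g y) powr p) \<partial>lborel)"
    using p c by (intro nn_integral_mono ennreal_leI powr_mono2) auto
  moreover have "(\<integral>\<^sup>+ y. ennreal (c powr p) \<partial>(lborel :: real measure)) = \<infinity>"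
    using c by (simp add: ennreal_mult_top)
  ultimately show False using fin by (simp add: top_unique)
qed

lemma norm_le_powr_nn_integral_deriv:
  fixes g g' :: "real \<Rightarrow> complex"
  assumes p: "0 < p" "p < 1"
    and deriv: "\<And>x. (g has_vector_derivative g' x) (at x)"
    and cont: "continuous_on UNIV g'"
    and fin: "(\<integral>\<^sup>+ x. ennreal (norm (g x) powr p) \<partial>lborel) < \<infinity>"
    and I: "0 \<le> I" "(\<integral>\<^sup>+ x. ennreal (norm (g' x) powr p) \<partial>lborel) \<le> ennreal I"
    and S: "0 \<le> S" "\<And>x. norm (g' x) \<le> S"
  shows "norm (g x) \<le> S powr (1 - p) * I"
proof (rule norm_le_nn_integral_deriv[OF deriv cont p(1) fin])
  have [measurable]: "g' \<in> borel_measurable borel"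
    using cont by (rule borel_measurable_continuous_onI)
  have "norm (g' x) \<le> S powr (1 - p) * norm (g' x) powr p" for x
  proof -
    have "norm (g' x) = norm (g' x) powr (1 - p) * norm (g' x) powr p"
      by (simp add: powr_add[symmetric])
    also have "\<dots> \<le> S powr (1 - p) * norm (g' x) powr p"
      using p S by (intro mult_right_mono powr_mono2) auto
    finally show ?thesis .
  qed
  then have "(\<integral>\<^sup>+ x. ennreal (norm (g' x)) \<partial>lborel)
      \<le> (\<integral>\<^sup>+ x. ennreal (S powr (1 - p)) * ennreal (norm (g' x) powr p) \<partial>lborel)"
    by (intro nn_integral_mono) (simp add: ennreal_mult[symmetric] ennreal_leI)
  also have "\<dots> = ennreal (S powr (1 - p)) * (\<integral>\<^sup>+ x. ennreal (norm (g' x) powr p) \<partial>lborel)"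
    by (simp add: nn_integral_cmult)
  also have "\<dots> \<le> ennreal (S powr (1 - p)) * ennreal I"
    by (intro mult_left_mono I) simp
  finally show "(\<integral>\<^sup>+ x. ennreal (norm (g' x)) \<partial>lborel) \<le> ennreal (S powr (1 - p) * I)"
    using I by (simp add: ennreal_mult)
  show "0 \<le> S powr (1 - p) * I" using I by simp
qed

lemma continuous_on_nth_deriv:
  assumes "smooth_fun f"
  shows "continuous_on A (nth_deriv n f)"
proof (rule continuous_at_imp_continuous_on, intro ballI)
  show "isCont (nth_deriv n f) x" for x
    using assms by (intro differentiable_imp_continuous_within) (simp add: smooth_fun_def)
qed

text \<open>In logarithms, one use of the sup norm inequality sends a bound \<open>s\<close> for one
  derivative to \<open>(1 - p) * s + p * ln w\<close> for the preceding one. Iterating this affine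
  map produces the geometric weights.\<close>

lemma nth_deriv_bound_iterate:
  fixes w :: "nat \<Rightarrow> real"
  assumes p: "0 < p" "p < 1" and f: "smooth_fun f" and w: "\<And>n. 0 < w n"
    and int: "\<And>n. (\<integral>\<^sup>+ x. ennreal (norm (nth_deriv n f x) powr p) \<partial>lborel) \<le> ennreal (w n powr p)"
    and bound: "\<And>x. norm (nth_deriv (n + m) f x) \<le> exp s"
  shows "norm (nth_deriv n f x) \<le> exp ((1 - p) ^ m * s + (\<Sum>j<m. p * (1 - p) ^ j * ln (w (n + j + 1))))"
  using bound
proof (induction m arbitrary: s)
  case (Suc m)
  have "norm (nth_deriv (n + m) f x) \<le> exp ((1 - p) * s + p * ln (w (n + m + 1)))" for x
  proof -
    have "norm (nth_deriv (n + m) f x) \<le> exp s powr (1 - p) * w (Suc (n + m)) powr p"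
    proof (rule norm_le_powr_nn_integral_deriv[OF p smooth_fun_has_vector_derivative[OF f]
          continuous_on_nth_deriv[OF f]])
      show "(\<integral>\<^sup>+ x. ennreal (norm (nth_deriv (n + m) f x) powr p) \<partial>lborel) < \<infinity>"
        using int[of "n + m"] by (rule le_less_trans) simp
    qed (use int[of "Suc (n + m)"] Suc.prems in auto)
    then show ?thesis
      using w[of "Suc (n + m)"] by (simp add: powr_def exp_add)
  qed
  from Suc.IH[OF this] show ?case
    by (simp add: algebra_simps)
qed simp

text \<open>After \<open>m\<close> iterations the starting bound enters with the factor
  \<open>(1 - p) ^ m\<close>. By the growth condition with \<open>\<theta> = 0\<close> it
  contributes at most \<open>\<delta> / (1 - p) ^ n\<close> for every positive
  \<open>\<delta>\<close>, so only \<open>L\<close> and the norm bound remain.\<close>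

lemma test_class_bound:
  fixes M :: "nat \<Rightarrow> real"
  assumes p: "0 < p" "p < 1" and M: "weight_sequence M"
    and f: "f \<in> test_class p 0 M" and K: "0 < K" "carleman_norm p M f \<le> ennreal K"
    and L: "(\<lambda>j. p * (1 - p) ^ j * ln (M (n + j + 1))) sums L"
  shows "norm (nth_deriv n f x) \<le> K * exp L"
proof -
  have smooth: "smooth_fun f"
    and growth: "limsup (\<lambda>m. ereal ((1 - p) ^ m) * ext_ln (sup_norm (nth_deriv m f))) \<le> 0"
    using f by (auto simp: test_class_def zero_ereal_def)
  have Mpos: "0 < M m" for m using M by (simp add: weight_sequence_def)
  define w where "w m = K * M m" for m
  have w: "0 < w m" for m using K Mpos by (simp add: w_def)
  have int: "(\<integral>\<^sup>+ x. ennreal (norm (nth_deriv m f x) powr p) \<partial>lborel) \<le> ennreal (w m powr p)" for m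
  proof -
    have "Lp_norm p (nth_deriv m f) \<le> ennreal (w m)"
      using K carleman_norm_le_iff[OF M, of K p f] by (simp add: w_def)
    then show ?thesis
      using Lp_norm_le_iff[OF p(1), of "w m" "nth_deriv m f"] w[of m] by simp
  qed
  \<comment> \<open>The weights have total mass 1, so \<open>K\<close> comes out to the first
    power.\<close>
  have geom: "(\<lambda>j. p * (1 - p) ^ j) sums 1"
    using sums_mult[OF geometric_sums[of "1 - p"], of p] p by simp
  have "(\<lambda>j. p * (1 - p) ^ j * ln K + p * (1 - p) ^ j * ln (M (n + j + 1))) sums (1 * ln K + L)"
    by (intro sums_add sums_mult2 geom L)
  moreover have "p * (1 - p) ^ j * ln K + p * (1 - p) ^ j * ln (M (n + j + 1)) =
      p * (1 - p) ^ j * ln (w (n + j + 1))" for j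
    using K Mpos[of "n + j + 1"] by (simp add: w_def ln_mult_pos distrib_left)
  ultimately have sums: "(\<lambda>j. p * (1 - p) ^ j * ln (w (n + j + 1))) sums (ln K + L)"
    by simp
  \<comment> \<open>\<open>\<delta>\<close> is fixed while \<open>m\<close> tends to infinity, and
    tends to 0 only afterwards.\<close>
  have "norm (nth_deriv n f x) \<le> exp (\<delta> / (1 - p) ^ n + (ln K + L))" if \<delta>: "0 < \<delta>" for \<delta>
  proof -
    have "eventually (\<lambda>m. ereal ((1 - p) ^ m) * ext_ln (sup_norm (nth_deriv m f)) < ereal \<delta>) sequentially"
      using \<delta> growth by (intro Limsup_lessD) (simp add: le_less_trans)
    then have ev: "eventually (\<lambda>m. ereal ((1 - p) ^ (n + m)) * ext_ln (sup_norm (nth_deriv (n + m) f)) < ereal \<delta>) sequentially"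
      unfolding eventually_sequentially by (meson trans_le_add2)
    have "eventually (\<lambda>m. norm (nth_deriv n f x) \<le>
        exp (\<delta> / (1 - p) ^ n + (\<Sum>j<m. p * (1 - p) ^ j * ln (w (n + j + 1))))) sequentially"
      using ev
    proof eventually_elim
      case (elim m)
      define S where "S = sup_norm (nth_deriv (n + m) f)"
      have q: "0 < (1 - p) ^ (n + m)" using p by simp
      have "S \<noteq> \<infinity>"
      proof
        assume "S = \<infinity>"
        then have "ereal ((1 - p) ^ (n + m)) * ext_ln S = \<infinity>"
          using p by (simp add: ext_ln_def)
        then have "\<infinity> < ereal \<delta>" using elim by (simp only: S_def)
        then show False by simp
      qed
      then have S: "S = ennreal (enn2real S)" by (simp add: less_top)
      \<comment> \<open>A zero sup norm has extended logarithm \<open>-\<infinity>\<close> and is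
        treated apart from the real logarithm.\<close>
      have "enn2real S \<le> exp (\<delta> / (1 - p) ^ (n + m))"
      proof (cases "enn2real S = 0")
        case False
        then have pos: "0 < enn2real S" by (simp add: less_le)
        then have "S \<noteq> 0" by auto
        then have "(1 - p) ^ (n + m) * ln (enn2real S) < \<delta>"
          using elim \<open>S \<noteq> \<infinity>\<close> by (simp add: ext_ln_def S_def)
        then have "ln (enn2real S) \<le> \<delta> / (1 - p) ^ (n + m)"
          using q by (simp add: pos_le_divide_eq mult.commute)
        then show ?thesis using pos by (metis exp_le_cancel_iff exp_ln)
      qed simp
      then have "S \<le> ennreal (exp (\<delta> / (1 - p) ^ (n + m)))"
        using S by (metis ennreal_leI)
      then have "norm (nth_deriv (n + m) f y) \<le> exp (\<delta> / (1 - p) ^ (n + m))" for y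
        by (simp add: S_def sup_norm_le_iff)
      from nth_deriv_bound_iterate[OF p smooth w int this]
      show ?case using p by (simp add: power_add)
    qed
    moreover have "(\<lambda>m. exp (\<delta> / (1 - p) ^ n + (\<Sum>j<m. p * (1 - p) ^ j * ln (w (n + j + 1)))))
        \<longlonglongrightarrow> exp (\<delta> / (1 - p) ^ n + (ln K + L))"
      using sums unfolding sums_def by (intro tendsto_intros)
    ultimately show ?thesis
      by (intro tendsto_lowerbound[OF _ _ sequentially_bot])
  qed
  then have "eventually (\<lambda>\<delta>. norm (nth_deriv n f x) \<le> exp (\<delta> / (1 - p) ^ n + (ln K + L))) (at_right 0)"
    by (auto simp: eventually_at_right_less intro: eventually_mono[OF eventually_at_right_less])
  moreover have "((\<lambda>\<delta>. exp (\<delta> / (1 - p) ^ n + (ln K + L))) \<longlongrightarrow> exp (0 / (1 - p) ^ n + (ln K + L))) (at_right 0)"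
    using p by (intro tendsto_intros) auto
  ultimately have "norm (nth_deriv n f x) \<le> exp (0 / (1 - p) ^ n + (ln K + L))"
    by (intro tendsto_lowerbound[where F = "at_right 0"]) auto
  then show ?thesis using K by (simp add: exp_add)
qed

section \<open>The completion and its smooth representatives\<close>

lemma carleman_norm_zero:
  assumes "0 < p" "weight_sequence M"
  shows "carleman_norm p M (\<lambda>x. 0) = 0"
proof -
  have "nth_deriv n (\<lambda>x. 0) = (\<lambda>x. 0)" for n
    using nth_deriv_unique[of "\<lambda>n x. 0" n] by simp
  then have "carleman_norm p M (\<lambda>x. 0) \<le> ennreal 0"
    using carleman_norm_le_iff[OF assms(2), of 0 p "\<lambda>x. 0"] Lp_norm_le_iff[OF assms(1), of 0 "\<lambda>x. 0"]
    by simp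
  then show ?thesis by simp
qed

text \<open>Subadditivity holds for the \<open>p\<close>-th powers of the norms, whence the form of
  the bound. It serves to bound a Cauchy sequence uniformly.\<close>

lemma carleman_norm_triangle:
  assumes p: "0 < p" "p < 1" and M: "weight_sequence M"
    and smooth: "smooth_fun f" "smooth_fun g"
    and K: "0 \<le> K" "carleman_norm p M (\<lambda>x. f x - g x) \<le> ennreal K"
    and L: "0 \<le> L" "carleman_norm p M g \<le> ennreal L"
  shows "carleman_norm p M f \<le> ennreal ((K powr p + L powr p) powr (1 / p))"
proof -
  have "Lp_norm p (nth_deriv n f) \<le> ennreal ((K powr p + L powr p) powr (1 / p) * M n)" for n
  proof -
    have Mn: "0 < M n" using M by (simp add: weight_sequence_def)
    have [measurable]: "nth_deriv n f \<in> borel_measurable borel" "nth_deriv n g \<in> borel_measurable borel"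
      using smooth by (auto intro!: borel_measurable_continuous_onI continuous_on_nth_deriv)
    have "norm (nth_deriv n f x) powr p \<le> norm (nth_deriv n f x - nth_deriv n g x) powr p + norm (nth_deriv n g x) powr p" for x
    proof -
      have "norm (nth_deriv n f x) \<le> norm (nth_deriv n f x - nth_deriv n g x) + norm (nth_deriv n g x)"
        using norm_triangle_ineq[of "nth_deriv n f x - nth_deriv n g x" "nth_deriv n g x"] by simp
      then have "norm (nth_deriv n f x) powr p \<le> (norm (nth_deriv n f x - nth_deriv n g x) + norm (nth_deriv n g x)) powr p"
        using p by (intro powr_mono2) auto
      also have "\<dots> \<le> norm (nth_deriv n f x - nth_deriv n g x) powr p + norm (nth_deriv n g x) powr p"
        by (intro powr_add_le p) auto
      finally show ?thesis .
    qed
    then have "(\<integral>\<^sup>+ x. ennreal (norm (nth_deriv n f x) powr p) \<partial>lborel)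
       \<le> (\<integral>\<^sup>+ x. ennreal (norm (nth_deriv n f x - nth_deriv n g x) powr p) + ennreal (norm (nth_deriv n g x) powr p) \<partial>lborel)"
      by (intro nn_integral_mono) (simp add: ennreal_plus[symmetric] ennreal_leI del: ennreal_plus)
    also have "\<dots> = (\<integral>\<^sup>+ x. ennreal (norm (nth_deriv n f x - nth_deriv n g x) powr p) \<partial>lborel)
        + (\<integral>\<^sup>+ x. ennreal (norm (nth_deriv n g x) powr p) \<partial>lborel)"
      by (simp add: nn_integral_add)
    also have "\<dots> \<le> ennreal ((K * M n) powr p) + ennreal ((L * M n) powr p)"
    proof (rule add_mono)
      have "Lp_norm p (nth_deriv n (\<lambda>x. f x - g x)) \<le> ennreal (K * M n)"
        using K carleman_norm_le_iff[OF M] by blast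
      then show "(\<integral>\<^sup>+ x. ennreal (norm (nth_deriv n f x - nth_deriv n g x) powr p) \<partial>lborel) \<le> ennreal ((K * M n) powr p)"
        using Lp_norm_le_iff[OF p(1), of "K * M n"] K Mn by (simp add: smooth_fun_diff[OF smooth])
      have "Lp_norm p (nth_deriv n g) \<le> ennreal (L * M n)"
        using L carleman_norm_le_iff[OF M] by blast
      then show "(\<integral>\<^sup>+ x. ennreal (norm (nth_deriv n g x) powr p) \<partial>lborel) \<le> ennreal ((L * M n) powr p)"
        using Lp_norm_le_iff[OF p(1), of "L * M n"] L Mn by simp
    qed
    also have "\<dots> = ennreal (((K powr p + L powr p) powr (1 / p) * M n) powr p)"
      using p K L Mn by (simp add: ennreal_plus[symmetric] powr_mult powr_powr algebra_simps del: ennreal_plus)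
    finally show ?thesis
      using Lp_norm_le_iff[OF p(1), of "(K powr p + L powr p) powr (1 / p) * M n" "nth_deriv n f"] Mn by simp
  qed
  then show ?thesis
    using carleman_norm_le_iff[OF M, of "(K powr p + L powr p) powr (1 / p)"] by simp
qed

text \<open>A Cauchy sequence is eventually within norm 1 of one member, so
  \<open>test_class_bound\<close> holds along it with one constant. Convergence in the
  \<open>p\<close>-norm carries the bound to every point because the derivatives of the limit are
  continuous.\<close>

lemma carleman_space_bound:
  fixes M :: "nat \<Rightarrow> real"
  assumes p: "0 < p" "p < 1" and M: "weight_sequence M"
    and L: "\<And>n. (\<lambda>j. p * (1 - p) ^ j * ln (M (n + j + 1))) sums L n"
    and f: "f \<in> carleman_space p 0 M"
  obtains C where "0 < C" "\<And>n x. norm (nth_deriv n f x) \<le> C * exp (L n)"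
proof -
  obtain X where smooth: "smooth_fun f" and X: "X \<in> carleman_completion p 0 M"
    and rep: "represents_in_Lp p X (\<lambda>n. nth_deriv n f)"
    using f by (auto simp: carleman_space_def)
  obtain F where F: "carleman_Cauchy p 0 M F" and XF: "X = carleman_equiv p 0 M `` {F}"
    using X by (auto simp: carleman_completion_def elim: quotientE)
  have "F \<in> X"
    using F carleman_norm_zero[OF p(1) M] by (simp add: XF carleman_equiv_def)
  then have lim: "(\<lambda>i. Lp_norm p (\<lambda>x. nth_deriv n (F i) x - nth_deriv n f x)) \<longlonglongrightarrow> 0" for n
    using rep by (simp add: represents_in_Lp_def)
  have test: "F i \<in> test_class p 0 M" for i
    using F by (simp add: carleman_Cauchy_def)
  then have smoothF: "smooth_fun (F i)" for i
    by (simp add: test_class_def)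
  obtain I where I: "\<forall>i\<ge>I. \<forall>j\<ge>I. carleman_norm p M (\<lambda>x. F i x - F j x) < ennreal 1"
    using F unfolding carleman_Cauchy_def by (metis zero_less_one)
  have "carleman_norm p M (F I) < \<infinity>"
    using test[of I] by (simp add: test_class_def)
  then obtain k where k: "0 \<le> k" "carleman_norm p M (F I) = ennreal k"
    by (cases "carleman_norm p M (F I)") auto
  define K where "K = (1 powr p + k powr p) powr (1 / p)"
  have K: "0 < K"
  proof -
    have "0 < 1 + k powr p" by (simp add: add_pos_nonneg)
    then show ?thesis by (simp add: K_def)
  qed
  have bound: "norm (nth_deriv n (F i) x) \<le> K * exp (L n)" if "I \<le> i" for i n x
  proof (rule test_class_bound[OF p M test K _ L])
    have "carleman_norm p M (\<lambda>x. F i x - F I x) \<le> ennreal 1"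
      using I that by (auto intro: less_imp_le)
    then show "carleman_norm p M (F i) \<le> ennreal K"
      unfolding K_def
      by (rule carleman_norm_triangle[OF p M smoothF smoothF zero_le_one _ k(1) eq_refl[OF k(2)]])
  qed
  have "norm (nth_deriv n f x) \<le> K * exp (L n)" for n x
  proof (rule ccontr)
    assume *: "\<not> ?thesis"
    \<comment> \<open>Half of the excess at \<open>x\<close> is spent on the variation of the limit
      near \<open>x\<close>; the other half remains as a gap to every late \<open>F i\<close>, on an
      interval of length \<open>\<eta>\<close>.\<close>
    define \<delta> where "\<delta> = (norm (nth_deriv n f x) - K * exp (L n)) / 2"
    have \<delta>: "0 < \<delta>" using * by (simp add: \<delta>_def)
    have "isCont (nth_deriv n f) x"
      using continuous_on_nth_deriv[OF smooth, of UNIV] by (simp add: continuous_on_eq_continuous_at)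
    then obtain \<eta> where \<eta>: "0 < \<eta>" "\<And>y. dist y x < \<eta> \<Longrightarrow> dist (nth_deriv n f y) (nth_deriv n f x) < \<delta>"
      using \<delta> by (auto simp: continuous_at_eps_delta)
    have large: "\<delta> powr p \<le> norm (nth_deriv n (F i) y - nth_deriv n f y) powr p"
      if "I \<le> i" "x - \<eta> / 2 \<le> y" "y \<le> x + \<eta> / 2" for i y
    proof -
      have "dist (nth_deriv n f y) (nth_deriv n f x) < \<delta>"
        using \<eta>(1) that by (intro \<eta>(2)) (auto simp: dist_real_def abs_if)
      then have "\<delta> \<le> norm (nth_deriv n (F i) y - nth_deriv n f y)"
        using bound[OF that(1), of n y] norm_triangle_ineq2[of "nth_deriv n f x" "nth_deriv n f y"]
          norm_triangle_ineq2[of "nth_deriv n f y" "nth_deriv n (F i) y"]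
        by (simp add: \<delta>_def dist_norm norm_minus_commute)
      then show ?thesis using \<delta> p by (simp add: powr_mono2)
    qed
    \<comment> \<open>Then \<open>c powr p\<close> is half of the mass that the gap puts on this
      interval.\<close>
    define c where "c = (\<delta> powr p * \<eta> / 2) powr (1 / p)"
    have c: "0 < c" using \<delta> \<eta> by (simp add: c_def)
    have "eventually (\<lambda>i. Lp_norm p (\<lambda>x. nth_deriv n (F i) x - nth_deriv n f x) < ennreal c) sequentially"
      using lim[of n] c by (intro order_tendstoD(2)) auto
    then have "eventually (\<lambda>i. Lp_norm p (\<lambda>x. nth_deriv n (F i) x - nth_deriv n f x) < ennreal c \<and> I \<le> i) sequentially"
      by (intro eventually_conj eventually_ge_at_top)
    then obtain i where i: "Lp_norm p (\<lambda>x. nth_deriv n (F i) x - nth_deriv n f x) < ennreal c" "I \<le> i"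
      using eventually_happens'[OF sequentially_bot] by blast
    have "ennreal (\<delta> powr p * \<eta>) = (\<integral>\<^sup>+ y. ennreal (\<delta> powr p) * indicator {x - \<eta> / 2..x + \<eta> / 2} y \<partial>lborel)"
      using \<eta> by (simp add: nn_integral_cmult_indicator ennreal_mult)
    also have "\<dots> \<le> (\<integral>\<^sup>+ y. ennreal (norm (nth_deriv n (F i) y - nth_deriv n f y) powr p) \<partial>lborel)"
      using large[OF i(2)] by (intro nn_integral_mono) (simp add: indicator_def ennreal_leI)
    also have "\<dots> \<le> ennreal (c powr p)"
      using i(1) c by (subst Lp_norm_le_iff[OF p(1), symmetric]) auto
    also have "c powr p = \<delta> powr p * \<eta> / 2"
      using \<delta> \<eta> p by (simp add: c_def powr_powr)
    finally show False using \<delta> \<eta> by (simp add: ennreal_le_iff)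
  qed
  with K show ?thesis by (rule that)
qed

text \<open>The constant sequence is Cauchy, and any sequence equivalent to it converges to
  \<open>f\<close> in the \<open>p\<close>-norm of every derivative.\<close>

lemma test_class_subset_carleman_space:
  assumes p: "0 < p" and M: "weight_sequence M" and f: "f \<in> test_class p \<theta> M"
  shows "f \<in> carleman_space p \<theta> M"
proof -
  have smooth: "smooth_fun f" using f by (simp add: test_class_def)
  define X where "X = carleman_equiv p \<theta> M `` {\<lambda>_. f}"
  have "carleman_Cauchy p \<theta> M (\<lambda>_. f)"
    using f carleman_norm_zero[OF p M] by (simp add: carleman_Cauchy_def)
  then have X: "X \<in> carleman_completion p \<theta> M"
    unfolding X_def carleman_completion_def by (intro quotientI) simp
  have "(\<lambda>i. Lp_norm p (\<lambda>x. nth_deriv n (F i) x - nth_deriv n f x)) \<longlonglongrightarrow> 0" if "F \<in> X" for F n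
  proof (rule order_tendstoI)
    have F: "carleman_Cauchy p \<theta> M F" and lim: "(\<lambda>i. carleman_norm p M (\<lambda>x. f x - F i x)) \<longlonglongrightarrow> 0"
      using that by (auto simp: X_def carleman_equiv_def)
    have smoothF: "smooth_fun (F i)" for i
      using F by (simp add: carleman_Cauchy_def test_class_def)
    have Mn: "0 < M n" using M by (simp add: weight_sequence_def)
    fix e :: ennreal assume "0 < e"
    then obtain r where r: "0 < r" "ennreal r < e"
    proof (cases e)
      case (real t)
      then show ?thesis
        using \<open>0 < e\<close> by (intro that[of "t / 2"]) (auto simp: ennreal_less_iff)
    next
      case top
      then show ?thesis by (intro that[of 1]) auto
    qed
    have "eventually (\<lambda>i. carleman_norm p M (\<lambda>x. f x - F i x) < ennreal (r / M n)) sequentially"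
      using lim r Mn by (intro order_tendstoD(2)) auto
    then show "eventually (\<lambda>i. Lp_norm p (\<lambda>x. nth_deriv n (F i) x - nth_deriv n f x) < e) sequentially"
    proof eventually_elim
      case (elim i)
      then have "carleman_norm p M (\<lambda>x. f x - F i x) \<le> ennreal (r / M n)"
        by (rule less_imp_le)
      then have "Lp_norm p (nth_deriv n (\<lambda>x. f x - F i x)) \<le> ennreal (r / M n * M n)"
        using carleman_norm_le_iff[OF M, of "r / M n" p "\<lambda>x. f x - F i x"] r Mn
        by (simp del: times_divide_eq_left)
      moreover have "Lp_norm p (nth_deriv n (\<lambda>x. f x - F i x)) = Lp_norm p (\<lambda>x. nth_deriv n (F i) x - nth_deriv n f x)"
        by (simp add: smooth_fun_diff[OF smooth smoothF] Lp_norm_def norm_minus_commute)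
      ultimately show ?case using r Mn by (simp add: le_less_trans)
    qed
  qed simp
  then show ?thesis
    using smooth X by (auto simp: carleman_space_def represents_in_Lp_def)
qed

lemma carleman_space_subset_class: "carleman_space p \<theta> M \<subseteq> Lp_carleman_class p \<theta> M"
proof
  fix f assume "f \<in> carleman_space p \<theta> M"
  then have "(\<lambda>t. f (1 * t)) \<in> Lp_carleman_class p \<theta> M"
    unfolding Lp_carleman_class_def using zero_less_one by blast
  then show "f \<in> Lp_carleman_class p \<theta> M" by simp
qed

section \<open>Nonquasianalytic and quasianalytic classes\<close>

lemma ext_ln_le:
  assumes "x \<le> ennreal (exp s)"
  shows "ext_ln x \<le> ereal s"
proof (cases x)
  case (real r)
  then have "r \<le> exp s" using assms by (simp add: ennreal_le_iff)
  then have "ln r \<le> s" if "r \<noteq> 0"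
    using real that ln_mono[of r "exp s"] by simp
  then show ?thesis
    using real by (simp add: ext_ln_def)
next
  case top
  then show ?thesis using assms by (simp add: top_unique)
qed

text \<open>What a choice of widths must achieve, for zero and positive \<open>\<theta>\<close>
  alike: integrals matched by \<open>M\<close>, and logarithmic sup norm bounds \<open>s n\<close>
  with growth rate \<open>\<theta>\<close>.\<close>

lemma bump_not_quasianalytic:
  fixes D :: "nat \<Rightarrow> real \<Rightarrow> real"
  assumes p: "0 < p" "p < 1" and M: "weight_sequence M"
    and D: "\<And>n x. (D n has_real_derivative D (Suc n) x) (at x)"
    and flat: "\<And>n. D n 0 = 0" and nz: "D 0 \<noteq> (\<lambda>x. 0)"
    and K: "0 \<le> K"
    and Lp: "\<And>n. (\<integral>\<^sup>+ x. ennreal (\<bar>D n x\<bar> powr p) \<partial>lborel) \<le> ennreal ((K * M n) powr p)"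
    and bound: "\<And>n x. \<bar>D n x\<bar> \<le> exp (s n)"
    and lim: "(\<lambda>n. (1 - p) ^ n * s n) \<longlonglongrightarrow> \<theta>"
  shows "\<not> quasianalytic (Lp_carleman_class p \<theta> M)"
proof -
  define G where "G n x = complex_of_real (D n x)" for n x
  define f where "f = G 0"
  have dG: "(G n has_vector_derivative G (Suc n) x) (at x)" for n x
    unfolding G_def using D[of n x]
    by (intro has_vector_derivative_of_real) (simp add: has_real_derivative_iff_has_vector_derivative)
  have nth: "nth_deriv n f = G n" for n
    unfolding f_def by (rule nth_deriv_unique[of G, OF dG])
  have smooth: "smooth_fun f"
    unfolding f_def by (rule smooth_funI[of G, OF dG])
  have Mn: "0 < M n" for n using M by (simp add: weight_sequence_def)
  have "carleman_norm p M f \<le> ennreal K"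
  proof (subst carleman_norm_le_iff[OF M K], intro allI)
    show "Lp_norm p (nth_deriv n f) \<le> ennreal (K * M n)" for n
      using Lp_norm_le_iff[OF p(1), of "K * M n" "G n"] Lp[of n] K Mn[of n]
      by (simp add: nth G_def)
  qed
  moreover have "limsup (\<lambda>n. ereal ((1 - p) ^ n) * ext_ln (sup_norm (nth_deriv n f))) \<le> ereal \<theta>"
  proof -
    have "sup_norm (nth_deriv n f) \<le> ennreal (exp (s n))" for n
      using bound[of n] by (simp add: sup_norm_le_iff nth G_def)
    then have "ereal ((1 - p) ^ n) * ext_ln (sup_norm (nth_deriv n f)) \<le> ereal ((1 - p) ^ n * s n)" for n
      using p ereal_mult_left_mono[OF ext_ln_le, of _ "s n" "ereal ((1 - p) ^ n)"] by simp
    then have "limsup (\<lambda>n. ereal ((1 - p) ^ n) * ext_ln (sup_norm (nth_deriv n f)))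
        \<le> limsup (\<lambda>n. ereal ((1 - p) ^ n * s n))"
      by (intro Limsup_mono always_eventually allI)
    also have "\<dots> = ereal \<theta>"
      using lim by (intro lim_imp_Limsup) auto
    finally show ?thesis .
  qed
  ultimately have "f \<in> test_class p \<theta> M"
    using smooth by (auto simp: test_class_def intro: le_less_trans)
  then have "f \<in> Lp_carleman_class p \<theta> M"
    using test_class_subset_carleman_space[OF p(1) M] carleman_space_subset_class by blast
  moreover have "nth_deriv n f 0 = 0" for n
    by (simp add: nth G_def flat)
  moreover have "f \<noteq> (\<lambda>x. 0)"
    using nz by (auto simp: f_def G_def fun_eq_iff)
  ultimately show ?thesis
    unfolding quasianalytic_def by blast
qed

text \<open>A tail of the widths is comparable to its first term, and its smallness offsets the size
  of the \<open>n\<close>-th derivative: all integrals are bounded by one constant \<open>B\<close>,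
  which the lower bound on \<open>M\<close> turns into a finite Carleman norm.\<close>

lemma not_quasianalytic_pos:
  fixes M :: "nat \<Rightarrow> real"
  assumes p: "0 < p" "p < 1" and M: "weight_sequence M"
    and c: "0 < c" "\<And>n. c \<le> M n" and \<theta>: "0 < \<theta>"
  shows "\<not> quasianalytic (Lp_carleman_class p \<theta> M)"
proof -
  define q where "q = 1 - p"
  have q: "0 < q" "q < 1" using p by (auto simp: q_def)
  \<comment> \<open>The constant \<open>ln 2 / p\<close> cancels the growth \<open>2 ^ n\<close> of
    the integral. The other term is chosen so that \<open>p\<close> times its sum over
    \<open>k \<le> n\<close> equals its value at \<open>n\<close> up to a constant.\<close>
  define a where "a k = exp (ln 2 / p - \<theta> * p / q ^ k)" for k
  have a: "0 < a k" for k by (simp add: a_def)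
  \<comment> \<open>Consecutive exponents drop by \<open>\<theta> * p\<^sup>2 / q ^ Suc k\<close>,
    which is at least \<open>\<theta> * p\<^sup>2\<close>; so \<open>r\<close> bounds the ratio of
    consecutive widths.\<close>
  define r where "r = exp (- \<theta> * p\<^sup>2)"
  have r: "0 < r" "r < 1" using \<theta> p by (auto simp: r_def)
  have a_Suc: "a (Suc k) \<le> r * a k" for k
  proof -
    have "\<theta> * p / q ^ Suc k - \<theta> * p / q ^ k = \<theta> * p\<^sup>2 * (1 / q ^ Suc k)"
      using q by (simp add: field_simps power2_eq_square q_def)
    moreover have "1 \<le> 1 / q ^ Suc k"
      using q power_le_one[of q "Suc k"] by (simp add: le_divide_eq_1 del: power_Suc)
    ultimately have "\<theta> * p\<^sup>2 \<le> \<theta> * p / q ^ Suc k - \<theta> * p / q ^ k"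
      using \<theta> p mult_left_mono[of 1 "1 / q ^ Suc k" "\<theta> * p\<^sup>2"] by simp
    then show ?thesis
      by (simp add: a_def r_def exp_add[symmetric] del: power_Suc)
  qed
  have a_le: "a (n + k) \<le> a n * r ^ k" for n k
  proof (induction k)
    case (Suc k)
    have "a (n + Suc k) \<le> r * a (n + k)" using a_Suc by simp
    also have "\<dots> \<le> r * (a n * r ^ k)" using Suc r by (intro mult_left_mono) auto
    finally show ?case by (simp add: mult_ac)
  qed simp
  have geom: "(\<lambda>k. a n * r ^ k) sums (a n * (1 / (1 - r)))" for n
    using r by (intro sums_mult geometric_sums) simp
  have summ: "summable (\<lambda>k. a (n + k))" for n
    by (rule summable_comparison_test[OF _ sums_summable[OF geom[of n]]])
      (use a_le a in \<open>auto simp: less_imp_le\<close>)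
  have tail: "(\<Sum>k. a (n + k)) \<le> a n / (1 - r)" for n
    using suminf_le[OF a_le summ sums_summable[OF geom]] sums_unique[OF geom[of n]] by simp
  have "summable a" using summ[of 0] by simp
  from bump_exists[OF p a this]
  obtain D :: "nat \<Rightarrow> real \<Rightarrow> real"
    where D: "\<And>n x. (D n has_real_derivative D (Suc n) x) (at x)"
      and D0: "\<And>n x. x \<le> 0 \<Longrightarrow> D n x = 0" and nz: "D 0 \<noteq> (\<lambda>x. 0)"
      and sup: "\<And>n x. \<bar>D n x\<bar> \<le> (\<Prod>k\<le>n. 2 / a k)"
      and Lp: "\<And>n. (\<integral>\<^sup>+ x. ennreal (\<bar>D n x\<bar> powr p) \<partial>lborel)
        \<le> ennreal (2 ^ n * 2 powr p * (\<Prod>k\<le>n. a k) powr - p * (\<Sum>k. a (n + k)))"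
    by blast
  have prod_a: "(\<Prod>k\<le>n. a k) = exp ((real n + 1) * ln 2 / p - \<theta> * (1 / q ^ n - q))" for n
  proof (induction n)
    case 0
    show ?case by (simp add: a_def q_def)
  next
    case (Suc n)
    have "\<theta> * p / q ^ Suc n = \<theta> * (1 / q ^ Suc n - 1 / q ^ n)"
      using q by (simp add: field_simps q_def)
    then have "(real n + 1) * ln 2 / p - \<theta> * (1 / q ^ n - q) + (ln 2 / p - \<theta> * p / q ^ Suc n) =
        (real (Suc n) + 1) * ln 2 / p - \<theta> * (1 / q ^ Suc n - q)"
      by (simp add: algebra_simps add_divide_distrib del: power_Suc)
    then show ?case
      by (simp only: prod.atMost_Suc Suc a_def[of "Suc n"] exp_add[symmetric])
  qed
  define B where "B = exp (p * ln 2 - ln 2 + ln 2 / p - p * \<theta> * q) / (1 - r)"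
  have B: "0 < B" using r by (simp add: B_def)
  have integral_le: "2 ^ n * 2 powr p * (\<Prod>k\<le>n. a k) powr - p * (\<Sum>k. a (n + k)) \<le> B" for n
  proof -
    have "2 ^ n * 2 powr p * (\<Prod>k\<le>n. a k) powr - p * (\<Sum>k. a (n + k))
        \<le> 2 ^ n * 2 powr p * (\<Prod>k\<le>n. a k) powr - p * (a n / (1 - r))"
      by (intro mult_left_mono tail) auto
    also have "2 ^ n * 2 powr p * (\<Prod>k\<le>n. a k) powr - p * (a n / (1 - r)) = B"
    proof -
      have two: "2 ^ n = exp (real n * ln (2::real))"
        by (simp add: exp_of_nat_mult)
      define e where "e = (real n + 1) * ln 2 / p - \<theta> * (1 / q ^ n - q)"
      have "p * e = (real n + 1) * ln 2 - p * (\<theta> * (1 / q ^ n - q))"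
        using p by (simp add: e_def right_diff_distrib)
      then have exponent: "real n * ln 2 + p * ln 2 + - p * e + (ln 2 / p - \<theta> * p / q ^ n) =
          p * ln 2 - ln 2 + ln 2 / p - p * \<theta> * q"
        by (simp add: algebra_simps)
      have "2 powr p = exp (p * ln 2)" by (simp add: powr_def)
      moreover have "(\<Prod>k\<le>n. a k) powr - p = exp (- p * e)"
        unfolding prod_a e_def[symmetric] by (simp add: powr_def)
      ultimately show ?thesis
        unfolding B_def exponent[symmetric] two by (simp only: a_def exp_add times_divide_eq_right)
    qed
    finally show ?thesis .
  qed
  define K where "K = B powr (1 / p) / c"
  show ?thesis
  proof (rule bump_not_quasianalytic[OF p M D D0[OF order_refl] nz])
    show "0 \<le> K" using c by (simp add: K_def)
    show "(\<integral>\<^sup>+ x. ennreal (\<bar>D n x\<bar> powr p) \<partial>lborel) \<le> ennreal ((K * M n) powr p)" for n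
    proof -
      have "B powr (1 / p) = K * c" using c by (simp add: K_def)
      also have "\<dots> \<le> K * M n" using c by (intro mult_left_mono) (auto simp: K_def)
      finally have "(B powr (1 / p)) powr p \<le> (K * M n) powr p"
        using p by (intro powr_mono2) auto
      then have "B \<le> (K * M n) powr p" using p B by (simp add: powr_powr)
      then show ?thesis
        using integral_le[of n] by (intro order_trans[OF Lp] ennreal_leI) simp
    qed
    \<comment> \<open>The powers of 2 contribute a nonpositive exponent because \<open>1 / p\<close>
      exceeds 1; the exponent kept, scaled by \<open>(1 - p) ^ n\<close>, is exactly
      \<open>\<theta>\<close>.\<close>
    show "\<bar>D n x\<bar> \<le> exp (\<theta> / q ^ n)" for n x
    proof -
      have "(\<Prod>k\<le>n. 2 / a k) = exp ((real n + 1) * ln 2) / (\<Prod>k\<le>n. a k)"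
        using exp_of_nat_mult[of "Suc n" "ln (2::real)"] by (simp add: prod_dividef add.commute)
      also have "\<dots> = exp ((real n + 1) * ln 2 - (real n + 1) * ln 2 / p + \<theta> * (1 / q ^ n - q))"
        by (simp add: prod_a exp_diff[symmetric])
      also have "\<dots> \<le> exp (\<theta> / q ^ n)"
      proof -
        have "(real n + 1) * ln 2 * p \<le> (real n + 1) * ln 2 * 1"
          using p by (intro mult_left_mono) auto
        then have "(real n + 1) * ln 2 \<le> (real n + 1) * ln 2 / p"
          using p by (simp add: pos_le_divide_eq)
        moreover have "\<theta> * (1 / q ^ n - q) \<le> \<theta> / q ^ n"
          using \<theta> q by (simp add: right_diff_distrib)
        ultimately show ?thesis by simp
      qed
      finally show ?thesis using sup[of n x] by simp
    qed
    show "(\<lambda>n. (1 - p) ^ n * (\<theta> / q ^ n)) \<longlonglongrightarrow> \<theta>"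
      using q by (simp add: q_def[symmetric])
  qed
qed

text \<open>The product of the widths telescopes to \<open>M 0 / M n\<close> up to a power of
  \<open>b\<close>, so both the sup norm and the \<open>p\<close>-norm of the \<open>n\<close>-th
  derivative are at most a constant times \<open>M n\<close>. Then \<open>growth\<close> yields the
  condition with \<open>\<theta> = 0\<close>.\<close>

lemma not_quasianalytic_zero:
  fixes M :: "nat \<Rightarrow> real"
  assumes p: "0 < p" "p < 1" and M: "weight_sequence M"
    and summ: "summable (\<lambda>n. M n / M (Suc n))"
    and growth: "(\<lambda>n. (1 - p) ^ n * ln (M n)) \<longlonglongrightarrow> 0"
  shows "\<not> quasianalytic (Lp_carleman_class p 0 M)"
proof -
  have Mn: "0 < M n" for n using M by (simp add: weight_sequence_def)
  \<comment> \<open>Its \<open>p\<close>-th power is 2, which cancels the \<open>2 ^ n\<close> in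
    the integral; being at least 2 it also absorbs the \<open>2 ^ n\<close> in the sup norm.\<close>
  define b where "b = 2 powr (1 / p)"
  have b: "2 \<le> b"
    using p powr_mono[of 1 "1 / p" 2] by (simp add: b_def)
  \<comment> \<open>The width \<open>a 0\<close> has no preceding weight and is set to 1; the shift
    by one makes the product up to index \<open>n\<close> end at \<open>M n\<close>.\<close>
  define a where "a k = (case k of 0 \<Rightarrow> 1 | Suc n \<Rightarrow> b * (M n / M (Suc n)))" for k
  have a: "0 < a k" for k using Mn b by (simp add: a_def split: nat.split)
  have "summable (\<lambda>n. a (Suc n))" using summable_mult[OF summ, of b] by (simp add: a_def)
  then have summ_a: "summable a" by (simp only: summable_Suc_iff)
  from bump_exists[OF p a this]
  obtain D :: "nat \<Rightarrow> real \<Rightarrow> real"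
    where D: "\<And>n x. (D n has_real_derivative D (Suc n) x) (at x)"
      and D0: "\<And>n x. x \<le> 0 \<Longrightarrow> D n x = 0" and nz: "D 0 \<noteq> (\<lambda>x. 0)"
      and sup: "\<And>n x. \<bar>D n x\<bar> \<le> (\<Prod>k\<le>n. 2 / a k)"
      and Lp: "\<And>n. (\<integral>\<^sup>+ x. ennreal (\<bar>D n x\<bar> powr p) \<partial>lborel)
        \<le> ennreal (2 ^ n * 2 powr p * (\<Prod>k\<le>n. a k) powr - p * (\<Sum>k. a (n + k)))"
    by blast
  have prod_a: "(\<Prod>k\<le>n. a k) = b ^ n * (M 0 / M n)" for n
  proof (induction n)
    case 0
    show ?case using Mn[of 0] by (simp add: a_def)
  next
    case (Suc n)
    then show ?case using Mn[of n] by (simp add: a_def)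
  qed
  define R where "R = (\<Sum>k. a k)"
  have R: "0 < R"
    unfolding R_def by (rule suminf_pos[OF summ_a a])
  have tail: "(\<Sum>k. a (n + k)) \<le> R" for n
  proof -
    have "(\<Sum>k. a (k + n)) = R - sum a {..<n}"
      unfolding R_def by (rule suminf_minus_initial_segment[OF summ_a])
    moreover have "0 \<le> sum a {..<n}" using a by (intro sum_nonneg) (simp add: less_imp_le)
    ultimately show ?thesis by (simp add: add.commute)
  qed
  define K where "K = 2 * R powr (1 / p) / M 0"
  show ?thesis
  proof (rule bump_not_quasianalytic[OF p M D D0[OF order_refl] nz])
    show "0 \<le> K" using Mn[of 0] by (simp add: K_def)
    show "(\<integral>\<^sup>+ x. ennreal (\<bar>D n x\<bar> powr p) \<partial>lborel) \<le> ennreal ((K * M n) powr p)" for n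
    proof -
      have "(b ^ n) powr p = 2 ^ n"
        using p by (simp add: b_def powr_power powr_powr powr_realpow)
      then have "2 ^ n * 2 powr p * (\<Prod>k\<le>n. a k) powr - p * R = 2 powr p * (M n / M 0) powr p * R"
        using Mn[of 0] Mn[of n] b by (simp add: prod_a powr_mult powr_minus_divide powr_divide)
      also have "\<dots> = (K * M n) powr p"
        using Mn[of 0] Mn[of n] R p by (simp add: K_def powr_mult powr_divide powr_powr)
      finally have "2 ^ n * 2 powr p * (\<Prod>k\<le>n. a k) powr - p * R = (K * M n) powr p" .
      moreover have "2 ^ n * 2 powr p * (\<Prod>k\<le>n. a k) powr - p * (\<Sum>k. a (n + k))
          \<le> 2 ^ n * 2 powr p * (\<Prod>k\<le>n. a k) powr - p * R"
        by (intro mult_left_mono tail) auto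
      ultimately show ?thesis
        by (intro order_trans[OF Lp] ennreal_leI) simp
    qed
    show "\<bar>D n x\<bar> \<le> exp (ln (2 / M 0) + ln (M n))" for n x
    proof -
      have "(\<Prod>k\<le>n. 2 / a k) = 2 * (2 ^ n / b ^ n) * (M n / M 0)"
        using Mn[of 0] Mn[of n] by (simp add: prod_dividef prod_a)
      also have "\<dots> \<le> 2 * 1 * (M n / M 0)"
        using Mn[of 0] Mn[of n] b by (intro mult_right_mono mult_left_mono) (auto simp: divide_le_eq_1 power_mono)
      also have "\<dots> = exp (ln (2 / M 0) + ln (M n))"
        using Mn[of 0] Mn[of n] by (simp add: exp_add)
      finally show ?thesis using sup[of n x] by simp
    qed
    have "(\<lambda>n. (1 - p) ^ n * ln (2 / M 0) + (1 - p) ^ n * ln (M n)) \<longlonglongrightarrow> 0 * ln (2 / M 0) + 0"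
      using p by (intro tendsto_add tendsto_mult growth tendsto_const LIMSEQ_power_zero) auto
    then show "(\<lambda>n. (1 - p) ^ n * (ln (2 / M 0) + ln (M n))) \<longlonglongrightarrow> 0"
      by (simp add: distrib_left)
  qed
qed

text \<open>The constants \<open>C\<close> and \<open>A\<close> merely scale the ratios by
  \<open>1 / A\<close>, so Bang's theorem applies with \<open>W\<close>, to the real and imaginary
  parts separately.\<close>

lemma carleman_class_quasianalytic:
  fixes N :: "nat \<Rightarrow> real"
  assumes N: "\<And>n. 0 < N n" and decr: "decseq (\<lambda>n. N n / N (Suc n))"
    and div: "\<not> summable (\<lambda>n. N n / N (Suc n))"
  shows "quasianalytic (carleman_class N)"
  unfolding quasianalytic_def
proof (intro ballI impI)
  fix f assume f: "f \<in> carleman_class N" and "\<exists>a. \<forall>n. nth_deriv n f a = 0"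
  then obtain a where flat: "\<And>n. nth_deriv n f a = 0" by blast
  obtain C A where CA: "0 < C" "0 < A" "\<And>k. sup_norm (nth_deriv k f) \<le> ennreal (C * A ^ k * N k)"
    and smooth: "smooth_fun f"
    using f by (auto simp: carleman_class_def)
  define W where "W n = C * A ^ n * N n" for n
  have W: "0 < W n" for n using CA N by (simp add: W_def)
  have ratio: "(\<lambda>n. W n / W (Suc n)) = (\<lambda>n. inverse A * (N n / N (Suc n)))"
    using CA by (auto simp: W_def fun_eq_iff field_simps)
  have decr': "decseq (\<lambda>n. W n / W (Suc n))"
    unfolding ratio decseq_def using CA by (intro allI impI mult_left_mono decseqD[OF decr]) auto
  have div': "\<not> summable (\<lambda>n. W n / W (Suc n))"
    unfolding ratio using div CA by (subst summable_cmult_iff) simp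
  have bound: "norm (nth_deriv n f x) \<le> W n" for n x
    using CA(3)[of n] W[of n] sup_norm_le_iff[of "W n"] by (simp add: W_def less_imp_le)
  note deriv = smooth_fun_has_vector_derivative[OF smooth]
  have "Re (nth_deriv 0 f x) = 0" for x
  proof (rule bang_quasianalytic[where d = "\<lambda>n x. Re (nth_deriv n f x)" and W = W and a = a])
    show "((\<lambda>x. Re (nth_deriv n f x)) has_real_derivative Re (nth_deriv (Suc n) f x)) (at x)" for n x
      using bounded_linear.has_vector_derivative[OF bounded_linear_Re deriv]
      by (simp add: has_real_derivative_iff_has_vector_derivative)
  qed (use W decr' div' flat order_trans[OF abs_Re_le_cmod bound] in auto)
  moreover have "Im (nth_deriv 0 f x) = 0" for x
  proof (rule bang_quasianalytic[where d = "\<lambda>n x. Im (nth_deriv n f x)" and W = W and a = a])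
    show "((\<lambda>x. Im (nth_deriv n f x)) has_real_derivative Im (nth_deriv (Suc n) f x)) (at x)" for n x
      using bounded_linear.has_vector_derivative[OF bounded_linear_Im deriv]
      by (simp add: has_real_derivative_iff_has_vector_derivative)
  qed (use W decr' div' flat order_trans[OF abs_Im_le_cmod bound] in auto)
  ultimately show "f = (\<lambda>x. 0)"
    by (auto simp: fun_eq_iff complex_eq_iff)
qed

section \<open>From the weights \<open>M\<close> to the weights \<open>N\<close>\<close>

lemma characteristic_summable:
  fixes M :: "nat \<Rightarrow> real"
  assumes p: "0 < p" "p < 1" and c: "0 < c" "\<And>n. c \<le> M n"
    and char: "p_characteristic p M < \<infinity>"
  shows "summable (\<lambda>j. (1 - p) ^ j * ln (M j))"
proof -
  define q where "q = 1 - p"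
  have q: "0 < q" "q < 1" using p by (auto simp: q_def)
  \<comment> \<open>Subtracting \<open>ln c\<close> makes the terms nonnegative, so that an eventual
    bound on partial sums, which is what the finite limit superior gives, implies
    convergence.\<close>
  define u where "u j = q ^ j * (ln (M j) - ln c)" for j
  have u: "0 \<le> u j" for j
    using c(1) c(2)[of j] q by (simp add: u_def)
  have geom: "summable (\<lambda>j. q ^ j)" using q by (intro summable_geometric) simp
  obtain B where B: "limsup (\<lambda>n. ereal (\<Sum>j=1..n. q ^ j * ln (M j))) < ereal B"
    using char less_PInf_Ex_of_nat[of "p_characteristic p M"]
    by (auto simp: p_characteristic_def q_def)
  then have "eventually (\<lambda>n. (\<Sum>j=1..n. q ^ j * ln (M j)) < B) sequentially"
    using Limsup_lessD by fastforce
  then obtain n0 where n0: "\<And>n. n0 \<le> n \<Longrightarrow> (\<Sum>j=1..n. q ^ j * ln (M j)) < B"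
    by (auto simp: eventually_sequentially)
  have "(\<Sum>j<n. u j) \<le> u 0 + B + \<bar>ln c\<bar> * (\<Sum>j. q ^ j)" for n
  proof -
    \<comment> \<open>The bound on partial sums holds from \<open>n0\<close> on; nonnegative terms
      allow the sum to be extended that far.\<close>
    define m where "m = max n n0"
    have "(\<Sum>j<n. u j) \<le> (\<Sum>j\<le>m. u j)"
      using u by (intro sum_mono2) (auto simp: m_def)
    also have "\<dots> = u 0 + (\<Sum>j=1..m. u j)"
      by (simp add: atMost_atLeast0 sum.atLeast_Suc_atMost)
    also have "(\<Sum>j=1..m. u j) = (\<Sum>j=1..m. q ^ j * ln (M j)) - ln c * (\<Sum>j=1..m. q ^ j)"
      by (simp add: u_def right_diff_distrib sum_subtractf sum_distrib_left mult.commute)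
    also have "- (ln c * (\<Sum>j=1..m. q ^ j)) \<le> \<bar>ln c\<bar> * (\<Sum>j. q ^ j)"
    proof -
      have S: "0 \<le> (\<Sum>j=1..m. q ^ j)" "(\<Sum>j=1..m. q ^ j) \<le> (\<Sum>j. q ^ j)"
        using q by (auto intro!: sum_nonneg sum_le_suminf geom)
      have "- (ln c * (\<Sum>j=1..m. q ^ j)) \<le> \<bar>ln c\<bar> * (\<Sum>j=1..m. q ^ j)"
        using S(1) mult_right_mono[of "- ln c" "\<bar>ln c\<bar>"] by simp
      also have "\<dots> \<le> \<bar>ln c\<bar> * (\<Sum>j. q ^ j)"
        using S(2) by (intro mult_left_mono) auto
      finally show ?thesis .
    qed
    then have "(\<Sum>j=1..m. q ^ j * ln (M j)) - ln c * (\<Sum>j=1..m. q ^ j) \<le> B + \<bar>ln c\<bar> * (\<Sum>j. q ^ j)"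
      using n0[of m] by (simp add: m_def)
    finally show ?thesis by simp
  qed
  then have "summable u"
    using u by (intro summableI_nonneg_bounded) auto
  then have "summable (\<lambda>j. u j + q ^ j * ln c)"
    by (intro summable_add summable_mult2 geom)
  then show ?thesis
    by (simp add: u_def q_def algebra_simps)
qed

text \<open>\<open>\<sigma> n = ln (M (n + 1) / M n)\<close> is the slope of \<open>ln M\<close>; a weighted mean of the later slopes is
  the slope of \<open>ln N\<close>. Since \<open>\<sigma>\<close> grows at most linearly, the slopes beyond index \<open>2 n + 1\<close> contribute
  only a bounded amount to the mean.\<close>

lemma summable_slopes:
  fixes \<sigma> :: "nat \<Rightarrow> real"
  assumes p: "0 < p" "p < 1" and inc: "incseq \<sigma>"
    and lin: "\<And>n. \<sigma> n \<le> l * real n" and l: "0 \<le> l"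
    and sums: "\<And>n. (\<lambda>j. p * (1 - p) ^ j * \<sigma> (n + j + 1)) sums \<nu> n"
    and summ: "summable (\<lambda>n. exp (- \<nu> n))"
  shows "summable (\<lambda>n. exp (- \<sigma> n))"
proof -
  \<comment> \<open>Odd indices are sampled because among the slopes averaged in
    \<open>\<nu> n\<close>, those with \<open>j \<le> n\<close> are at most
    \<open>\<sigma> (2 * n + 1)\<close>.\<close>
  define v where "v n = exp (- \<sigma> (2 * n + 1))" for n
  have geom: "(\<lambda>j. p * (1 - p) ^ j) sums 1"
    using sums_mult[OF geometric_sums[of "1 - p"], of p] p by simp
  have "summable (\<lambda>j. real (Suc j) * (1 - p) ^ j)"
    using p by (intro sums_summable[OF geometric_deriv_sums]) simp
  from summable_mult[OF this, of "2 * l * p"]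
  have sc: "summable (\<lambda>j. p * (1 - p) ^ j * (2 * l * real (Suc j)))"
    by (simp only: mult_ac)
  define c where "c = (\<Sum>j. p * (1 - p) ^ j * (2 * l * real (Suc j)))"
  have \<nu>: "\<nu> n \<le> max (\<sigma> (2 * n + 1)) 0 + c" for n
  proof -
    \<comment> \<open>Truncated at 0 so that it can be added to the linear bound in both cases
      below.\<close>
    define \<Lambda> where "\<Lambda> = max (\<sigma> (2 * n + 1)) 0"
    have \<Lambda>: "0 \<le> \<Lambda>" "\<sigma> (2 * n + 1) \<le> \<Lambda>" by (auto simp: \<Lambda>_def)
    have "\<sigma> (n + j + 1) \<le> \<Lambda> + 2 * l * real (Suc j)" for j
    proof (cases "j \<le> n")
      case True
      then have "\<sigma> (n + j + 1) \<le> \<sigma> (2 * n + 1)" using incseqD[OF inc, of "n + j + 1" "2 * n + 1"] by simp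
      moreover have "0 \<le> 2 * l * real (Suc j)" using l by simp
      ultimately show ?thesis using \<Lambda> by linarith
    next
      case False
      then have "l * real (n + j + 1) \<le> l * (2 * real (Suc j))"
        using l by (intro mult_left_mono) auto
      then have "\<sigma> (n + j + 1) \<le> 2 * l * real (Suc j)"
        using lin[of "n + j + 1"] by (simp add: mult_ac)
      then show ?thesis using \<Lambda> by linarith
    qed
    then have le: "p * (1 - p) ^ j * \<sigma> (n + j + 1) \<le> p * (1 - p) ^ j * \<Lambda> + p * (1 - p) ^ j * (2 * l * real (Suc j))" for j
      using p mult_left_mono[of "\<sigma> (n + j + 1)" "\<Lambda> + 2 * l * real (Suc j)" "p * (1 - p) ^ j"]
      by (simp add: distrib_left)
    have "(\<lambda>j. p * (1 - p) ^ j * \<Lambda> + p * (1 - p) ^ j * (2 * l * real (Suc j))) sums (1 * \<Lambda> + c)"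
      unfolding c_def by (intro sums_add sums_mult2 geom summable_sums sc)
    from sums_le[OF le sums this] show ?thesis by (simp add: \<Lambda>_def)
  qed
  \<comment> \<open>The minimum with 1 mirrors the truncation at 0. It disappears later, since
    summability forces \<open>v\<close> below 1 eventually.\<close>
  have min_le: "min (v n) 1 \<le> exp c * exp (- \<nu> n)" for n
  proof -
    have "min (v n) 1 = exp (- max (\<sigma> (2 * n + 1)) 0)"
      by (auto simp: v_def min_def max_def)
    also have "\<dots> \<le> exp (c + - \<nu> n)" using \<nu>[of n] by simp
    finally show ?thesis by (simp add: exp_add exp_diff exp_minus divide_simps)
  qed
  have summ_min: "summable (\<lambda>n. min (v n) 1)"
    by (rule summable_comparison_test[OF _ summable_mult[OF summ, of "exp c"]])
      (use min_le in \<open>auto simp: v_def\<close>)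
  then have "(\<lambda>n. min (v n) 1) \<longlonglongrightarrow> 0" by (rule summable_LIMSEQ_zero)
  then have "eventually (\<lambda>n. min (v n) 1 < 1) sequentially"
    by (rule order_tendstoD) simp
  then have "eventually (\<lambda>n. min (v n) 1 = v n) sequentially"
    by eventually_elim auto
  then have summ_v: "summable v"
    using summ_min summable_cong[of "\<lambda>n. min (v n) 1" v] by simp
  define u where "u n = exp (- \<sigma> n)" for n
  have u: "0 \<le> u n" for n by (simp add: u_def)
  \<comment> \<open>The terms decrease, so those at \<open>2 * k + 1\<close> and
    \<open>2 * k + 2\<close> are both at most \<open>v k\<close>.\<close>
  have "(\<Sum>k<2 * n + 1. u k) \<le> u 0 + 2 * (\<Sum>k<n. v k)" for n
  proof (induction n)
    case (Suc n)
    have "u (2 * n + 2) \<le> v n"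
      using incseqD[OF inc, of "2 * n + 1" "2 * n + 2"] by (simp add: u_def v_def)
    then show ?case using Suc by (simp add: u_def[of "Suc (2 * n)"] v_def[of n])
  qed simp
  then have odd_le: "(\<Sum>k<2 * n + 1. u k) \<le> u 0 + 2 * (\<Sum>k<n. v k)" for n .
  have "(\<Sum>k<n. u k) \<le> u 0 + 2 * suminf v" for n
  proof -
    have "(\<Sum>k<n. u k) \<le> (\<Sum>k<2 * n + 1. u k)"
      using u by (intro sum_mono2) auto
    also have "\<dots> \<le> u 0 + 2 * (\<Sum>k<n. v k)" by (rule odd_le)
    also have "(\<Sum>k<n. v k) \<le> suminf v"
      by (rule sum_le_suminf[OF summ_v]) (auto simp: v_def)
    finally show ?thesis by simp
  qed
  then have "summable u"
    using u by (intro summableI_nonneg_bounded)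
  then show ?thesis by (simp add: u_def[abs_def])
qed

theorem theorem0p6p4:
  fixes p :: real and M N :: "nat \<Rightarrow> real"
  assumes "0 < p" and "p < 1"
    and "weight_sequence M"
    and "log_convex M"
    and "\<exists>c>0. \<forall>n. c \<le> M n"
    and "\<And>n. N n = (\<Prod>j. M (n + (j + 1)) powr ((1 - p) ^ j * p))"
    and "p_characteristic p M < \<infinity>"
  shows "(\<forall>\<theta>>0. \<not> quasianalytic (Lp_carleman_class p \<theta> M)) \<and>
         (decay_regular p M \<longrightarrow>
            (quasianalytic (Lp_carleman_class p 0 M) \<longleftrightarrow> quasianalytic (carleman_class N)))"
proof -
  note p = assms(1,2) and M = assms(3)
  have Mn: "0 < M n" for n using M by (simp add: weight_sequence_def)
  obtain c where c: "0 < c" "\<And>n. c \<le> M n" using assms(5) by blast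
  have summ: "summable (\<lambda>j. (1 - p) ^ j * ln (M j))"
    by (rule characteristic_summable[OF p c assms(7)])
  \<comment> \<open>The logarithm of \<open>N n\<close>; up to the factor
    \<open>p / (1 - p) ^ (n + 1)\<close> it is a tail of the series in \<open>summ\<close>.\<close>
  define L where "L n = (\<Sum>j. p * (1 - p) ^ j * ln (M (n + j + 1)))" for n
  have L: "(\<lambda>j. p * (1 - p) ^ j * ln (M (n + j + 1))) sums L n" for n
  proof -
    have "summable (\<lambda>j. (p / (1 - p) ^ (n + 1)) * ((1 - p) ^ (j + (n + 1)) * ln (M (j + (n + 1)))))"
      using summ by (intro summable_mult summable_ignore_initial_segment)
    moreover have "(p / (1 - p) ^ (n + 1)) * ((1 - p) ^ (j + (n + 1)) * ln (M (j + (n + 1)))) =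
        p * (1 - p) ^ j * ln (M (n + j + 1))" for j
      using p by (simp add: power_add ac_simps)
    ultimately show ?thesis unfolding L_def by (simp add: summable_sums)
  qed
  have N: "N n = exp (L n)" for n
  proof -
    have "M (n + (j + 1)) powr ((1 - p) ^ j * p) = exp (p * (1 - p) ^ j * ln (M (n + j + 1)))" for j
      using Mn[of "n + (j + 1)"] by (simp add: powr_def mult_ac add_ac)
    then show ?thesis
      using prodinf_exp[OF sums_summable[OF L[of n]]] sums_unique[OF L[of n]]
      by (simp add: assms(6))
  qed
  \<comment> \<open>Ratios of consecutive weights become exponentials of negated slopes. The slope
    of \<open>ln N\<close> is a weighted mean of later slopes of \<open>ln M\<close>, so it inherits
    their monotonicity.\<close>
  define slope where "slope n = ln (M (Suc n)) - ln (M n)" for n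
  have inc: "incseq slope"
  proof (rule incseq_SucI)
    show "slope n \<le> slope (Suc n)" for n
      using assms(4) unfolding log_convex_def slope_def by (auto dest: spec[of _ n])
  qed
  have slope_N: "(\<lambda>j. p * (1 - p) ^ j * slope (n + j + 1)) sums (L (Suc n) - L n)" for n
    using sums_diff[OF L[of "Suc n"] L[of n]] by (simp add: slope_def algebra_simps)
  have ratio_N: "N n / N (Suc n) = exp (- (L (Suc n) - L n))" for n
    by (simp add: N exp_diff)
  have ratio_M: "M n / M (Suc n) = exp (- slope n)" for n
    using Mn by (simp add: slope_def exp_diff)
  have "\<not> quasianalytic (Lp_carleman_class p \<theta> M)" if "0 < \<theta>" for \<theta>
    by (rule not_quasianalytic_pos[OF p M c that])
  moreover have "quasianalytic (Lp_carleman_class p 0 M)" if qa: "quasianalytic (carleman_class N)"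
  proof -
    \<comment> \<open>A dilation by \<open>a\<close> multiplies the \<open>k\<close>-th derivative
      by \<open>a ^ k\<close>, which is the geometric factor allowed in the Carleman class;
      quasianalyticity passes to subclasses.\<close>
    have "Lp_carleman_class p 0 M \<subseteq> carleman_class N"
    proof
      fix g assume "g \<in> Lp_carleman_class p 0 M"
      then obtain f a where g: "g = (\<lambda>t. f (a * t))" and f: "f \<in> carleman_space p 0 M" and a: "0 < a"
        by (auto simp: Lp_carleman_class_def)
      have smooth: "smooth_fun f" using f by (simp add: carleman_space_def)
      obtain C where C: "0 < C" "\<And>n x. norm (nth_deriv n f x) \<le> C * exp (L n)"
        using carleman_space_bound[OF p M L f] by blast
      have "sup_norm (nth_deriv k g) \<le> ennreal (C * a ^ k * N k)" for k
      proof (subst sup_norm_le_iff)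
        show "\<forall>x. norm (nth_deriv k g x) \<le> C * a ^ k * N k"
        proof
          fix x
          have "norm (nth_deriv k g x) = a ^ k * norm (nth_deriv k f (a * x))"
            using a by (simp add: g smooth_fun_dilate[OF smooth])
          also have "\<dots> \<le> a ^ k * (C * exp (L k))"
            using a by (intro mult_left_mono C) simp
          finally show "norm (nth_deriv k g x) \<le> C * a ^ k * N k"
            by (simp add: N mult_ac)
        qed
      qed (use C a N in simp)
      then show "g \<in> carleman_class N"
        using smooth_fun_dilate(1)[OF smooth, of a] C(1) a g by (auto simp: carleman_class_def)
    qed
    then show ?thesis using qa by (auto simp: quasianalytic_def)
  qed
  moreover have "quasianalytic (carleman_class N)"
    if dr: "decay_regular p M" and qa: "quasianalytic (Lp_carleman_class p 0 M)"
  proof (rule carleman_class_quasianalytic)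
    show "0 < N n" for n by (simp add: N)
    have "L (Suc n) - L n \<le> L (Suc (Suc n)) - L (Suc n)" for n
    proof (rule sums_le[OF _ slope_N slope_N])
      show "p * (1 - p) ^ j * slope (n + j + 1) \<le> p * (1 - p) ^ j * slope (Suc n + j + 1)" for j
        using p incseqD[OF inc, of "n + j + 1" "Suc n + j + 1"] by (intro mult_left_mono) auto
    qed
    then show "decseq (\<lambda>n. N n / N (Suc n))"
      unfolding ratio_N by (intro decseq_SucI) (simp only: exp_le_cancel_iff neg_le_iff_le)
    show "\<not> summable (\<lambda>n. N n / N (Suc n))"
    proof
      \<comment> \<open>Decay regularity would make the ratios of \<open>M\<close> summable as well,
        and \<open>not_quasianalytic_zero\<close> then contradicts \<open>qa\<close>.\<close>
      assume summ_N: "summable (\<lambda>n. N n / N (Suc n))"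
      have "summable (\<lambda>n. M n / M (Suc n))"
      proof (cases "summable (\<lambda>n. M (n + 1) / M (n + 2))")
        case True
        \<comment> \<open>This alternative starts at the second ratio; one more term does not affect
          convergence.\<close>
        then show ?thesis using summable_Suc_iff[of "\<lambda>n. M n / M (Suc n)"] by simp
      next
        case False
        then obtain \<epsilon> where \<epsilon>: "0 < \<epsilon>" "\<And>n. \<epsilon> ^ n \<le> M n / M (n + 1)"
          using dr by (auto simp: decay_regular_def)
        \<comment> \<open>\<open>\<epsilon>\<close> may exceed 1, so the maximum secures a
          nonnegative rate.\<close>
        define l where "l = max 0 (- ln \<epsilon>)"
        have "slope n \<le> l * real n" for n
        proof -
          have "ln (\<epsilon> ^ n) \<le> ln (exp (- slope n))"
            using \<epsilon>(1) \<epsilon>(2)[of n] ratio_M[of n] by (intro ln_mono) auto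
          then have "slope n \<le> - ln \<epsilon> * real n"
            using \<epsilon>(1) by (simp add: ln_realpow mult.commute)
          also have "\<dots> \<le> l * real n" by (intro mult_right_mono) (auto simp: l_def)
          finally show ?thesis .
        qed
        then have "summable (\<lambda>n. exp (- slope n))"
          by (rule summable_slopes[OF p inc _ _ slope_N])
            (use summ_N in \<open>simp_all add: ratio_N l_def\<close>)
        then show ?thesis by (simp add: ratio_M)
      qed
      \<comment> \<open>The growth condition on \<open>M\<close> holds because the terms of the
        convergent series in \<open>summ\<close> tend to 0.\<close>
      then show False
        using not_quasianalytic_zero[OF p M _ summable_LIMSEQ_zero[OF summ]] qa by blast
    qed
  qed
  ultimately show ?thesis by blast
qed

end
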